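(* Let $k,n\ge1$, let $\sigma\in\mathfrak{S}^{(k)}_n$ be a $132$-avoiding $k$-Stirling permutation, and let $\mu=\alpha(\sigma)$ be the $k$-Dyck path from $(0,0)$ to $(kn,n)$ corresponding to $\sigma$. Then $$\sum_{D\in \mathcal{D}^{(k)}( */\mu)} q^{\mathrm{tiles}(D)} = \sum_{\pi\ge\sigma} q^{\mathrm{inv}_k(\pi)-\mathrm{inv}_k(\sigma)},$$ where the sum on the right is over all $\pi\in\mathfrak{S}^{(k)}_n$ with $\pi\ge\sigma$ in the $k$-Bruhat order.
   Context: $k$-Dyck tilings. A $k$-Dyck path is a lattice path of up steps $(0,1)$ and down steps $(1,0)$ from $(0,0)$ to $(kn,n)$ (for some $n\ge0$) which never goes below the line $y=x/k$. Cells are unit squares with integer corners. A $k$-Dyck tile is a ribbon (finite set of cells) such that the centers of its cells are the lattice points of a translate of a $k$-Dyck path (the path of length $0$ is allowed, giving a single cell). For $k$-Dyck paths $\lambda,\mu$ from $(0,0)$ to $(kn,n)$ with $\mu$ weakly above $\lambda$, a (cover-inclusive) $k$-Dyck tiling of $\lambda/\mu$ is a tiling $D$ by $k$-Dyck tiles of the region between $\lambda$ and $\mu$ such that if $\eta$ is a tile of $D$, then the translate of $\eta$ by $(1,-1)$ is either completely below $\lambda$ or contained in another tile of $D$. $\mathcal{D}^{(k)}( */\mu)$ is the set of $k$-Dyck tilings with fixed upper path $\mu$, and $\mathrm{tiles}(D)$ is the number of tiles of $D$. $k$-Stirling permutations. $\mathfrak{S}^{(k)}_n$ is the set of $k$-Stirling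 permutations of size $n$: arrangements $\pi=\pi_1\cdots\pi_{kn}$ of the multiset $\{1^k,2^k,\dots,n^k\}$ such that if an integer $j\neq i$ appears between two $i$'s then $i>j$. A $k$-inversion of $\pi$ is a pair $(i,j)\in[n]\times[kn]$ such that $\pi_j>i$ and the first $i$ in $\pi$ appears after position $j$; $\mathrm{INV}_k(\pi)$ is the set of $k$-inversions and $\mathrm{inv}_k(\pi)=|\mathrm{INV}_k(\pi)|$. $k$-Bruhat order. For $\sigma,\pi\in\mathfrak{S}^{(k)}_n$ write $\sigma\lessdot\pi$ if $\pi$ is obtained from $\sigma$ by exchanging the two numbers in positions $a_1$ and $a_{k+1}$ for some integers $a_1<a_2<\dots<a_{k+1}$ with (1) $\sigma_{a_1}=\sigma_{a_2}=\dots=\sigma_{a_k}<\sigma_{a_{k+1}}$, and (2) for all $a_k<i<a_{k+1}$, either $\sigma_i<\sigma_{a_1}$ or $\sigma_i>\sigma_{a_{k+1}}$. The $k$-Bruhat order is the partial order on $\mathfrak{S}^{(k)}_n$ with cover relation $\lessdot$ (its reflexive-transitive closure). The map $\alpha$. $\sigma\in\mathfrak{S}^{(k)}_n$ is $132$-avoiding if there are no $1\le i<j<l\le kn$ with $\sigma_i<\sigma_l<\sigma_j$. View $k$-inversions $(i,j)$ as cells in row $i$ from the top and column $j$ from the left of an $n\times kn$ grid. For $\sigma$ $132$-avoiding, $\mathrm{INV}_k(\sigma)$ is a top-left justified Ferrers diagram, and $\alpha(\sigma)$ is the path from the bottom-left corner $(0,0)$ to the top-right corner $(kn,n)$ of the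 grid following the boundary of this diagram (cells of the diagram lie above the path). $\alpha$ is a bijection from $132$-avoiding $k$-Stirling permutations of size $n$ to $k$-Dyck paths from $(0,0)$ to $(kn,n)$. *)

theory Defs
  imports "HOL-Library.Multiset" "HOL-Computational_Algebra.Polynomial"
begin

subsection \<open>\<open>k\<close>-Dyck paths\<close>

text \<open>An up step is \<open>(0,1)\<close>, a down step is \<open>(1,0)\<close>; a path starts at the origin.\<close>

datatype step = Up | Down

definition vertex :: "step list \<Rightarrow> nat \<Rightarrow> int \<times> int" where
  "vertex p m = (int (count_list (take m p) Down), int (count_list (take m p) Up))"

definition vertices :: "step list \<Rightarrow> (int \<times> int) set" where
  "vertices p = vertex p ` {..length p}"

text \<open>For \<open>k \<ge> 1\<close>, not going below the line \<open>y = x / k\<close> means \<open>x \<le> k * y\<close>. Since the steps are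
  axis-parallel, it is enough to check this at the lattice points of the path.\<close>

definition kdyck_path :: "nat \<Rightarrow> nat \<Rightarrow> step list \<Rightarrow> bool" where
  "kdyck_path k n p \<longleftrightarrow>
     vertex p (length p) = (int (k * n), int n) \<and>
     (\<forall>m\<le>length p. fst (vertex p m) \<le> int k * snd (vertex p m))"

subsection \<open>Tilings\<close>

text \<open>The cell \<open>[x, x+1] \<times> [y, y+1]\<close> is represented by its lower left corner \<open>(x, y)\<close>. It lies below
  (resp. above) a path iff it lies below (resp. above) the down step of the path in column \<open>x\<close>.\<close>

type_synonym cell = "int \<times> int"

definition cell_below :: "step list \<Rightarrow> cell \<Rightarrow> bool" where
  "cell_below p c \<longleftrightarrow>
     (\<exists>m<length p. p ! m = Down \<and> fst (vertex p m) = fst c \<and> snd c < snd (vertex p m))"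

definition cell_above :: "step list \<Rightarrow> cell \<Rightarrow> bool" where
  "cell_above p c \<longleftrightarrow>
     (\<exists>m<length p. p ! m = Down \<and> fst (vertex p m) = fst c \<and> snd (vertex p m) \<le> snd c)"

definition weakly_above :: "step list \<Rightarrow> step list \<Rightarrow> bool" where
  "weakly_above \<mu> \<nu> \<longleftrightarrow> (\<forall>c. cell_below \<nu> c \<longrightarrow> cell_below \<mu> c)"

definition skew_region :: "step list \<Rightarrow> step list \<Rightarrow> cell set" where
  "skew_region \<nu> \<mu> = {c. cell_above \<nu> c \<and> cell_below \<mu> c}"

definition translate :: "int \<times> int \<Rightarrow> cell set \<Rightarrow> cell set" where
  "translate v \<eta> = (\<lambda>c. (fst c + fst v, snd c + snd v)) ` \<eta>"

text \<open>Passing from cell centers to lower left corners is a translation, so the corners of the cells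
  of a tile are the lattice points of an integer translate of a \<open>k\<close>-Dyck path.\<close>

definition kdyck_tile :: "nat \<Rightarrow> cell set \<Rightarrow> bool" where
  "kdyck_tile k \<eta> \<longleftrightarrow> (\<exists>m p v. kdyck_path k m p \<and> \<eta> = translate v (vertices p))"

definition kdyck_tiling :: "nat \<Rightarrow> step list \<Rightarrow> step list \<Rightarrow> cell set set \<Rightarrow> bool" where
  "kdyck_tiling k \<nu> \<mu> D \<longleftrightarrow>
     (\<forall>\<eta>\<in>D. kdyck_tile k \<eta>) \<and>
     (\<forall>\<eta>\<in>D. \<forall>\<theta>\<in>D. \<eta> \<noteq> \<theta> \<longrightarrow> \<eta> \<inter> \<theta> = {}) \<and>
     \<Union>D = skew_region \<nu> \<mu> \<and>
     (\<forall>\<eta>\<in>D. (\<forall>c\<in>translate (1, -1) \<eta>. cell_below \<nu> c) \<or>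
             (\<exists>\<theta>\<in>D. \<theta> \<noteq> \<eta> \<and> translate (1, -1) \<eta> \<subseteq> \<theta>))"

text \<open>The lower path need not be recorded: it is determined by \<open>\<mu>\<close> and the region \<open>\<Union>D\<close>.\<close>

definition kdyck_tilings_above :: "nat \<Rightarrow> nat \<Rightarrow> step list \<Rightarrow> cell set set set" where
  "kdyck_tilings_above k n \<mu> =
     {D. \<exists>\<nu>. kdyck_path k n \<nu> \<and> weakly_above \<mu> \<nu> \<and> kdyck_tiling k \<nu> \<mu> D}"

subsection \<open>\<open>k\<close>-Stirling permutations\<close>

text \<open>Permutations are lists, so positions are numbered from 0, while values range over \<open>{1..n}\<close>.\<close>

definition kstirling :: "nat \<Rightarrow> nat \<Rightarrow> nat list set" where
  "kstirling k n =
     {\<pi>. mset \<pi> = (\<Sum>i\<in>{1..n}. replicate_mset k i) \<and>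
         (\<forall>a b c. a < b \<and> b < c \<and> c < length \<pi> \<and> \<pi> ! a = \<pi> ! c \<and> \<pi> ! b \<noteq> \<pi> ! a
            \<longrightarrow> \<pi> ! b < \<pi> ! a)}"

definition first_pos :: "nat list \<Rightarrow> nat \<Rightarrow> nat" where
  "first_pos \<pi> i = (LEAST m. m < length \<pi> \<and> \<pi> ! m = i)"

definition INVk :: "nat \<Rightarrow> nat list \<Rightarrow> (nat \<times> nat) set" where
  "INVk n \<pi> = {(i, j). i \<in> {1..n} \<and> j < length \<pi> \<and> \<pi> ! j > i \<and> first_pos \<pi> i > j}"

definition invk :: "nat \<Rightarrow> nat list \<Rightarrow> nat" where
  "invk n \<pi> = card (INVk n \<pi>)"

definition avoids_132 :: "nat list \<Rightarrow> bool" where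
  "avoids_132 \<sigma> \<longleftrightarrow>
     \<not> (\<exists>i j l. i < j \<and> j < l \<and> l < length \<sigma> \<and> \<sigma> ! i < \<sigma> ! l \<and> \<sigma> ! l < \<sigma> ! j)"

text \<open>The list \<open>as\<close> below holds the positions \<open>a\<^sub>1 < \<dots> < a\<^sub>k\<^sub>+\<^sub>1\<close>, i.e. \<open>as ! 0 < \<dots> < as ! k\<close>.\<close>

definition kbruhat_cover :: "nat \<Rightarrow> nat \<Rightarrow> nat list \<Rightarrow> nat list \<Rightarrow> bool" where
  "kbruhat_cover k n \<sigma> \<pi> \<longleftrightarrow>
     \<sigma> \<in> kstirling k n \<and> \<pi> \<in> kstirling k n \<and>
     (\<exists>as. length as = k + 1 \<and> sorted_wrt (<) as \<and> as ! k < length \<sigma> \<and>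
        (\<forall>j<k. \<sigma> ! (as ! j) = \<sigma> ! (as ! 0)) \<and> \<sigma> ! (as ! 0) < \<sigma> ! (as ! k) \<and>
        (\<forall>i. as ! (k - 1) < i \<and> i < as ! k \<longrightarrow>
           \<sigma> ! i < \<sigma> ! (as ! 0) \<or> \<sigma> ! i > \<sigma> ! (as ! k)) \<and>
        \<pi> = \<sigma>[as ! 0 := \<sigma> ! (as ! k), as ! k := \<sigma> ! (as ! 0)])"

definition kbruhat_le :: "nat \<Rightarrow> nat \<Rightarrow> nat list \<Rightarrow> nat list \<Rightarrow> bool" where
  "kbruhat_le k n = (kbruhat_cover k n)\<^sup>*\<^sup>*"

subsection \<open>The map \<open>\<alpha>\<close>\<close>

text \<open>The cells of the diagram \<open>INVk n \<sigma>\<close> fill the first \<open>inv_row n \<sigma> i\<close> cells of row \<open>i\<close> from the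
  top, and these numbers weakly decrease in \<open>i\<close> (for \<open>132\<close>-avoiding \<open>\<sigma>\<close>). The boundary path runs from
  the bottom left corner through the rows \<open>n, \<dots>, 1\<close>: before going up along row \<open>i\<close>, it moves right
  from the end of row \<open>i + 1\<close> to the end of row \<open>i\<close>; row \<open>n + 1\<close> is empty.\<close>

definition inv_row :: "nat \<Rightarrow> nat list \<Rightarrow> nat \<Rightarrow> nat" where
  "inv_row n \<sigma> i = card {j. (i, j) \<in> INVk n \<sigma>}"

definition alpha :: "nat \<Rightarrow> nat \<Rightarrow> nat list \<Rightarrow> step list" where
  "alpha k n \<sigma> =
     concat (map (\<lambda>i. replicate (inv_row n \<sigma> i - inv_row n \<sigma> (i + 1)) Down @ [Up]) (rev [1..<n + 1]))
     @ replicate (k * n - inv_row n \<sigma> 1) Down"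

subsection \<open>Monotonicity of \<open>invk\<close>\<close>

text \<open>By \<open>invk_mono\<close> below, differences \<open>invk n \<pi> - invk n \<sigma>\<close> along the order are not truncated.\<close>

lemma kstirling_between:
  assumes "\<pi> \<in> kstirling k n" "a < b" "b < c" "c < length \<pi>" "\<pi> ! a = \<pi> ! c" "\<pi> ! b \<noteq> \<pi> ! a"
  shows "\<pi> ! b < \<pi> ! a"
  using assms unfolding kstirling_def mem_Collect_eq by metis

lemma count_kstirling:
  assumes "\<pi> \<in> kstirling k n"
  shows "count (mset \<pi>) i = (if i \<in> {1..n} then k else 0)"
  using assms unfolding kstirling_def by (simp add: count_sum)

lemma count_mset_card: "count (mset xs) x = card {m. m < length xs \<and> xs ! m = x}"
  by (simp add: count_mset count_list_eq_length_filter length_filter_conv_card eq_commute[of x])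

lemma first_pos_greater_iff:
  assumes "i \<in> set \<pi>"
  shows "j < first_pos \<pi> i \<longleftrightarrow> (\<forall>m\<le>j. m < length \<pi> \<longrightarrow> \<pi> ! m \<noteq> i)"
proof -
  obtain m where m: "m < length \<pi> \<and> \<pi> ! m = i"
    using assms by (auto simp: in_set_conv_nth)
  have 1: "first_pos \<pi> i < length \<pi> \<and> \<pi> ! first_pos \<pi> i = i"
    unfolding first_pos_def using m by (rule LeastI)
  have 2: "first_pos \<pi> i \<le> m" if "m < length \<pi>" "\<pi> ! m = i" for m
    unfolding first_pos_def using that by (intro Least_le) auto
  show ?thesis
  proof
    assume "j < first_pos \<pi> i"
    then show "\<forall>m\<le>j. m < length \<pi> \<longrightarrow> \<pi> ! m \<noteq> i"
      using 2 by (metis le_trans linorder_not_le)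
  next
    assume "\<forall>m\<le>j. m < length \<pi> \<longrightarrow> \<pi> ! m \<noteq> i"
    then show "j < first_pos \<pi> i"
      using 1 linorder_not_le by blast
  qed
qed

lemma INVk_iff:
  assumes "\<pi> \<in> kstirling k n" "k \<ge> 1"
  shows "(i, j) \<in> INVk n \<pi> \<longleftrightarrow>
    i \<in> {1..n} \<and> j < length \<pi> \<and> \<pi> ! j > i \<and> (\<forall>m\<le>j. \<pi> ! m \<noteq> i)"
proof (cases "i \<in> {1..n}")
  case True
  then have "i \<in> set \<pi>"
    using count_kstirling[OF assms(1), of i] assms(2) by (metis count_mset_0_iff not_one_le_zero)
  then show ?thesis using True by (auto simp: INVk_def first_pos_greater_iff)
qed (auto simp: INVk_def)

lemma finite_INVk: "finite (INVk n \<pi>)"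
  by (rule finite_subset[of _ "{1..n} \<times> {..<length \<pi>}"]) (auto simp: INVk_def)

lemma invk_cover_mono:
  assumes k: "k \<ge> 1" and cov: "kbruhat_cover k n \<sigma> \<pi>"
  shows "invk n \<sigma> \<le> invk n \<pi>"
proof -
  obtain as where S: "\<sigma> \<in> kstirling k n" and P: "\<pi> \<in> kstirling k n"
    and as: "length as = k + 1" "sorted_wrt (<) as" "as ! k < length \<sigma>"
      "\<forall>j<k. \<sigma> ! (as ! j) = \<sigma> ! (as ! 0)" "\<sigma> ! (as ! 0) < \<sigma> ! (as ! k)"
    and gap: "\<forall>i. as ! (k - 1) < i \<and> i < as ! k \<longrightarrow>
           \<sigma> ! i < \<sigma> ! (as ! 0) \<or> \<sigma> ! i > \<sigma> ! (as ! k)"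
    and pi: "\<pi> = \<sigma>[as ! 0 := \<sigma> ! (as ! k), as ! k := \<sigma> ! (as ! 0)]"
    using cov unfolding kbruhat_cover_def by (elim conjE exE) (rule that)
  define a b w u v where defs: "a = as ! 0" "b = as ! k" "w = as ! (k - 1)"
      "u = \<sigma> ! (as ! 0)" "v = \<sigma> ! (as ! k)"
  have ab: "a < b" and wb: "w < b"
    using as(1) k sorted_wrt_nth_less[OF as(2), of 0 k] sorted_wrt_nth_less[OF as(2), of "k - 1" k]
    by (auto simp: defs)
  have bl: "b < length \<sigma>" and uv: "u < v" and sa: "\<sigma> ! a = u" and sb: "\<sigma> ! b = v"
    using as(3,5) by (auto simp: defs)
  have sw: "\<sigma> ! w = u"
    unfolding defs using as(4) k by (metis diff_less less_le_trans zero_less_one)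
  have len: "length \<pi> = length \<sigma>"
    and pth: "\<And>m. \<pi> ! m = (if m = b then u else if m = a then v else \<sigma> ! m)"
    using ab bl unfolding pi defs
    by (auto simp: nth_list_update)
  have mid: "\<sigma> ! j \<le> u" if "a \<le> j" "j \<le> w" for j
  proof (cases "j = a \<or> j = w")
    case False
    then have "a < j" "j < w" "w < length \<sigma>" using that wb bl by auto
    then have "\<sigma> ! j \<noteq> u \<longrightarrow> \<sigma> ! j < u" using kstirling_between[OF S, of a j w] sa sw by auto
    then show ?thesis by auto
  qed (use sa sw in auto)
  have gap': "\<sigma> ! j < u \<or> \<sigma> ! j > v" if "w < j" "j < b" for j
    using gap that by (simp add: defs)
  have vn: "v \<in> {1..n}" and un: "u \<in> {1..n}"
    using count_kstirling[OF S, of v] count_kstirling[OF S, of u] bl ab sa sb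
    by (metis count_mset_0_iff nth_mem order.strict_trans)+
  define f where "f = (\<lambda>(c, j). if c = v \<and> j > a then (u, j)
      else if u < c \<and> c < v \<and> j = b then (c, a) else (c, j))"
  have no2: "k = 1" if j: "a < j" "j < b" "\<sigma> ! j > v" and nov: "\<forall>m\<le>j. \<sigma> ! m \<noteq> v" for j
  proof (rule ccontr)
    assume "k \<noteq> 1"
    have jw: "w < j" using mid[of j] j uv by force
    have nov': "\<sigma> ! m \<noteq> v" if "m < b" for m
    proof (cases "m \<le> j")
      case False
      then show ?thesis using gap'[of m] that jw uv by auto
    qed (use nov in blast)
    have "\<exists>b'>b. b' < length \<sigma> \<and> \<sigma> ! b' = v"
    proof (rule ccontr)
      assume no: "\<not> ?thesis"
      have "{m. m < length \<sigma> \<and> \<sigma> ! m = v} = {b}"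
        using no nov' bl sb by (auto) (metis linorder_neqE_nat)
      then have "count (mset \<sigma>) v = 1"
        by (simp add: count_mset_card)
      then show False using count_kstirling[OF S, of v] vn \<open>k \<noteq> 1\<close> by simp
    qed
    then obtain b' where b': "b < b'" "b' < length \<sigma>" "\<sigma> ! b' = v" by blast
    have "\<pi> ! a = \<pi> ! b'" "\<pi> ! j \<noteq> \<pi> ! a" "\<not> \<pi> ! j < \<pi> ! a" "a < j" "j < b'" "b' < length \<pi>"
      using b' j ab by (auto simp: pth len)
    then show False using kstirling_between[OF P, of a j b'] by blast
  qed
  have uniq: "\<sigma> ! m \<noteq> u" if "k = 1" "m < length \<sigma>" "m \<noteq> a" for m
  proof
    assume "\<sigma> ! m = u"
    then have "{a, m} \<subseteq> {m. m < length \<sigma> \<and> \<sigma> ! m = u}" using that sa ab bl by auto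
    then have "card {a, m} \<le> card {m. m < length \<sigma> \<and> \<sigma> ! m = u}" by (intro card_mono) auto
    also have "\<dots> = count (mset \<sigma>) u"
      by (simp add: count_mset_card)
    finally show False using count_kstirling[OF S, of u] un that by simp
  qed
  note iffs = INVk_iff[OF S k] INVk_iff[OF P k]
  have "f ` INVk n \<sigma> \<subseteq> INVk n \<pi>"
  proof safe
    fix c j c' j' assume I: "(c, j) \<in> INVk n \<sigma>" and F: "(c', j') = f (c, j)"
    have I': "c \<in> {1..n}" "j < length \<sigma>" "\<sigma> ! j > c" "\<And>m. m \<le> j \<Longrightarrow> \<sigma> ! m \<noteq> c"
      using I by (auto simp: iffs)
    consider "c = v" "j > a" | "u < c" "c < v" "j = b"
      | "\<not> (c = v \<and> j > a)" "\<not> (u < c \<and> c < v \<and> j = b)" by blast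
    then have "f (c, j) \<in> INVk n \<pi>"
    proof cases
      case 1
      have jb: "j < b" using I'(4)[of b] sb 1 by (metis linorder_not_le)
      have "k = 1" using no2[of j] 1 jb I' by auto
      then have "\<forall>m\<le>j. \<pi> ! m \<noteq> u" using uniq jb bl uv by (auto simp: pth)
      then show ?thesis using 1 jb un I' uv by (auto simp: f_def iffs pth len)
    next
      case 2
      then show ?thesis using I' ab bl by (auto simp: f_def iffs pth len)
    next
      case 3
      have f: "f (c, j) = (c, j)" using 3 by (auto simp: f_def)
      have ja: "j < a" if "c = u" using I'(4)[of a] sa that by (metis linorder_not_le)
      have jv: "j < a" if "c = v"
        using 3(1) I'(3) sa uv that by (metis less_irrefl linorder_neqE_nat order_less_trans)
      have "\<pi> ! m \<noteq> c" if "m \<le> j" for m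
        using I'(4)[OF that] ja jv that ab by (auto simp: pth)
      moreover have "\<pi> ! j > c"
      proof (cases "j = b")
        case True
        then have "c < v" "c \<noteq> u" using I'(3) I'(4)[of a] sa sb ab by auto
        then show ?thesis using 3(2) True by (auto simp: pth)
      qed (use I'(3) sa uv in \<open>auto simp: pth\<close>)
      ultimately show ?thesis using f I' by (simp add: iffs len)
    qed
    then show "(c', j') \<in> INVk n \<pi>" using F by simp
  qed
  moreover have "inj_on f (INVk n \<sigma>)"
  proof -
    have "(u, j) \<notin> INVk n \<sigma>" if "j > a" for j
      using that sa by (auto simp: iffs intro!: exI[of _ a])
    moreover have "(c, a) \<notin> INVk n \<sigma>" if "u < c" for c using that sa by (auto simp: iffs)
    ultimately have "c = c' \<and> j = j'"
      if "(c, j) \<in> INVk n \<sigma>" "(c', j') \<in> INVk n \<sigma>" "f (c, j) = f (c', j')" for c j c' j'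
      using that ab uv unfolding f_def prod.case by (simp split: if_splits; blast)
    then show ?thesis by (auto simp: inj_on_def)
  qed
  ultimately show ?thesis
    unfolding invk_def using finite_INVk by (metis card_inj_on_le)
qed

lemma invk_mono:
  assumes "k \<ge> 1" "kbruhat_le k n \<sigma> \<pi>"
  shows "invk n \<sigma> \<le> invk n \<pi>"
  using assms(2) unfolding kbruhat_le_def
proof (induction rule: rtranclp_induct)
  case (step \<tau> \<pi>)
  then show ?case using invk_cover_mono[OF assms(1) step.hyps(2)] by linarith
qed simp

end

theory Submission
  imports Defs
begin

text \<open>
Both sides are equal to the product over the rows \<open>i = 1, \<dots>, n\<close> of
\<open>1 + q + \<dots> + q ^ (k * (n - i) - c i)\<close>, where \<open>c i\<close> is the number of inversions of \<open>\<sigma>\<close> in row \<open>i\<close>.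
Row \<open>i\<close> has \<open>c i\<close> cells above \<open>\<mu>\<close> and \<open>k * (n - i)\<close> cells above the lowest \<open>k\<close>-Dyck path, so the
largest exponent is the number of its cells between these two paths.

Tilings. Let \<open>\<mu>'\<close> arise from \<open>\<mu>\<close> by deleting the last up step and \<open>k\<close> of the down steps after it. A
tile that starts in the top row is a single cell, because it cannot go up. Let \<open>t\<close> be the number of
such tiles in an unbroken run from the left end of the top row, and remove them. The next cell of the
top row, if it is in the region at all, now belongs to a tile that enters it from below by an up
step. As a \<open>k\<close>-Dyck path that has reached its final level, this tile must continue with at least \<open>k\<close>
down steps, so it contains the steps \<open>U D^k\<close> there. Cover-inclusiveness copies the pattern to every tile further
down the same antidiagonal, and finally to the lower path. Contracting all copies of \<open>U D^k\<close> at once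
yields a tiling with upper path \<open>\<mu>'\<close> and the same number of tiles. Conversely, every tiling with
upper path \<open>\<mu>'\<close> can be expanded at each of the last \<open>k * (n - 1) - c 1 + 1\<close> vertices of \<open>\<mu>'\<close>, along the
antidiagonal of this vertex, and the single cells can be put back. This gives the factor
\<open>\<Sum>t\<le>k * (n - 1) - c 1. q ^ t\<close> (\<open>bij_betw_grow\<close>). The contraction is one map \<open>squash\<close> of the whole plane of cells, and expanding
means taking preimages; therefore paths, regions, tiles and all conditions on a tiling are carried
over together (\<open>cover_inclusive_vimage_squash\<close>, \<open>unspread\<close>).

Permutations. The \<open>k\<close> copies of the smallest letter are contiguous, and the position of this block is
the first entry of the inversion code, while deleting it does not affect the other entries. So codes
are in bijection with the sequences bounded by \<open>k * (n - i)\<close>, and the permutations whose code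
dominates \<open>c\<close> have the same product as generating function (\<open>kstirling_generating_function\<close>). It
remains to see that these permutations form the up-set of \<open>\<sigma>\<close> (\<open>kbruhat_le_iff_row_count_le\<close>). As
\<open>\<sigma>\<close> avoids 132, its first \<open>c i\<close> letters all exceed \<open>i\<close>; a cover moves a larger letter to the left and
keeps this property, which in turn bounds the code from below. Conversely, any positive entry of a
code can be lowered by one along a cover without changing the other entries, so one can descend to
\<open>\<sigma>\<close>.
\<close>

section \<open>Lattice paths read along antidiagonals\<close>

text \<open>A path meets the antidiagonal \<open>x + y = i\<close> in one vertex, and \<open>downs p i\<close> is its abscissa. The
  argument is an integer and values beyond the ends of the path are constant, so that cells far away
  from the path need no separate treatment.\<close>

definition downs :: "step list \<Rightarrow> int \<Rightarrow> int" where
  "downs p i = int (count_list (take (nat i) p) Down)"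

lemma count_Up_Down: "count_list p Up + count_list p Down = length p"
proof (induction p)
  case (Cons s p)
  then show ?case by (cases s) auto
qed simp

lemma downs_nonpos [simp]: "i \<le> 0 \<Longrightarrow> downs p i = 0"
  by (simp add: downs_def)

lemma downs_nonneg [simp]: "0 \<le> downs p i"
  by (simp add: downs_def)

lemma downs_Suc:
  "m < length p \<Longrightarrow> downs p (int m + 1) = downs p (int m) + (if p ! m = Down then 1 else 0)"
  by (simp add: downs_def nat_add_distrib take_Suc_conv_app_nth)

lemma downs_beyond: "int (length p) \<le> i \<Longrightarrow> downs p i = downs p (int (length p))"
  by (simp add: downs_def)

lemma downs_step: "downs p i \<le> downs p (i + 1) \<and> downs p (i + 1) \<le> downs p i + 1"
proof -
  consider "i < 0" | "i \<ge> int (length p)" | "0 \<le> i" "i < int (length p)" by linarith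
  then show ?thesis
  proof cases
    case 2
    then show ?thesis using downs_beyond[of p i] downs_beyond[of p "i + 1"] by simp
  next
    case 3
    then show ?thesis using downs_Suc[of "nat i" p] by simp
  qed auto
qed

lemma downs_add: "downs p i \<le> downs p (i + int d) \<and> downs p (i + int d) \<le> downs p i + int d"
proof (induction d)
  case (Suc d)
  have "downs p (i + int (Suc d)) = downs p (i + int d + 1)" by (simp add: algebra_simps)
  then show ?case using Suc downs_step[of p "i + int d"] by simp
qed simp

lemma downs_mono: "i \<le> j \<Longrightarrow> downs p i \<le> downs p j"
  using downs_add[of p i "nat (j - i)"] by simp

lemma downs_lipschitz: "i \<le> j \<Longrightarrow> downs p j \<le> downs p i + (j - i)"
  using downs_add[of p i "nat (j - i)"] by simp

lemma vertex_downs: "m \<le> length p \<Longrightarrow> vertex p m = (downs p (int m), int m - downs p (int m))"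
  using count_Up_Down[of "take m p"] by (simp add: vertex_def downs_def)

lemma vertices_downs:
  "(x, y) \<in> vertices p \<longleftrightarrow> 0 \<le> x + y \<and> x + y \<le> int (length p) \<and> x = downs p (x + y)"
  (is "_ \<longleftrightarrow> ?R")
proof
  assume "(x, y) \<in> vertices p"
  then obtain m where "m \<le> length p" "(x, y) = vertex p m" by (auto simp: vertices_def)
  then show ?R by (simp add: vertex_downs)
next
  assume R: ?R
  then have "(x, y) = vertex p (nat (x + y))" by (subst vertex_downs) auto
  then show "(x, y) \<in> vertices p" using R by (auto simp: vertices_def)
qed

text \<open>With \<open>y = i - x\<close>, the condition \<open>x \<le> k * y\<close> reads \<open>(k + 1) * x \<le> k * i\<close>.\<close>

lemma kdyck_path_downs:
  "kdyck_path k n p \<longleftrightarrow> length p = (k + 1) * n \<and> downs p (int (length p)) = int (k * n) \<and>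
     (\<forall>i. 0 \<le> i \<and> i \<le> int (length p) \<longrightarrow> (int k + 1) * downs p i \<le> int k * i)"
proof -
  have "(\<forall>m\<le>length p. fst (vertex p m) \<le> int k * snd (vertex p m)) \<longleftrightarrow>
    (\<forall>m\<le>length p. (int k + 1) * downs p (int m) \<le> int k * int m)"
    by (auto simp: vertex_downs algebra_simps)
  also have "\<dots> \<longleftrightarrow> (\<forall>i. 0 \<le> i \<and> i \<le> int (length p) \<longrightarrow> (int k + 1) * downs p i \<le> int k * i)"
    by (metis nat_0_le nat_le_iff of_nat_0_le_iff of_nat_le_iff)
  finally have 1: "(\<forall>m\<le>length p. fst (vertex p m) \<le> int k * snd (vertex p m)) \<longleftrightarrow>
      (\<forall>i. 0 \<le> i \<and> i \<le> int (length p) \<longrightarrow> (int k + 1) * downs p i \<le> int k * i)" .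
  have 2: "vertex p (length p) = (int (k * n), int n) \<longleftrightarrow>
     length p = (k + 1) * n \<and> downs p (int (length p)) = int (k * n)"
    using vertex_downs[of "length p" p]
    by (auto simp: algebra_simps of_nat_mult[symmetric] of_nat_add[symmetric] simp del: of_nat_mult of_nat_add)
  show ?thesis unfolding kdyck_path_def 1 2 by blast
qed

text \<open>The abscissa grows by at most one per step, so it takes the value \<open>x\<close> immediately before a down
  step.\<close>

lemma downs_attained:
  assumes "downs p i \<le> x" "x < downs p (int (length p))" "0 \<le> x"
  obtains m where "m < length p" "p ! m = Down" "downs p (int m) = x" "i \<le> int m"
proof -
  define P where "P m \<longleftrightarrow> downs p (int m) > x" for m
  define M where "M = (LEAST m. P m)"
  have PL: "P (length p)" using assms by (simp add: P_def)
  have PM: "P M" unfolding M_def using PL by (rule LeastI)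
  have "M \<le> length p" unfolding M_def using PL by (rule Least_le)
  moreover have "M \<noteq> 0"
  proof
    assume "M = 0"
    then show False using PM assms(3) by (simp add: P_def)
  qed
  ultimately obtain m where m: "M = Suc m" "m < length p" by (cases M) auto
  have "\<not> P m" using m(1) not_less_Least[of m P] unfolding M_def by simp
  moreover have "downs p (int m + 1) > x" using PM m(1) by (simp add: P_def add.commute)
  ultimately have "p ! m = Down" "downs p (int m) = x"
    using downs_Suc[OF m(2)] by (auto simp: P_def split: if_splits)
  moreover have "i \<le> int m"
    using \<open>downs p (int m + 1) > x\<close> assms(1) downs_mono[of "int m + 1" i p] by linarith
  ultimately show thesis using that m(2) by blast
qed

text \<open>The upper left and the lower right corner of the cell \<open>(x, y)\<close> lie on the antidiagonal \<open>x + y + 1\<close>.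
  The cell is below the path iff the path crosses this antidiagonal at the upper left corner or
  further to the left.\<close>

lemma cell_below_downs:
  "cell_below p (x, y) \<longleftrightarrow> 0 \<le> x \<and> x < downs p (int (length p)) \<and> downs p (x + y + 1) \<le> x"
  (is "_ \<longleftrightarrow> ?R")
proof
  assume "cell_below p (x, y)"
  then obtain m where m: "m < length p" "p ! m = Down" "downs p (int m) = x" "x + y + 1 \<le> int m"
    by (auto simp: cell_below_def vertex_downs)
  then show ?R
    using downs_Suc[of m p] downs_mono[of "int m + 1" "int (length p)" p]
      downs_mono[of "x + y + 1" "int m" p] downs_nonneg[of p "int m"] by auto
next
  assume ?R
  then obtain m where "m < length p" "p ! m = Down" "downs p (int m) = x" "x + y + 1 \<le> int m"
    by (auto elim: downs_attained)
  then show "cell_below p (x, y)"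
    by (auto simp: cell_below_def vertex_downs intro!: exI[of _ m])
qed

lemma cell_above_downs:
  "cell_above p (x, y) \<longleftrightarrow> 0 \<le> x \<and> x < downs p (x + y + 1)"
  (is "_ \<longleftrightarrow> ?R")
proof
  assume "cell_above p (x, y)"
  then obtain m where m: "m < length p" "p ! m = Down" "downs p (int m) = x" "int m + 1 \<le> x + y + 1"
    by (auto simp: cell_above_def vertex_downs)
  then show ?R
    using downs_Suc[of m p] downs_mono[of "int m + 1" "x + y + 1" p] downs_nonneg[of p "int m"] by auto
next
  assume R: ?R
  have "downs p (x + y + 1) \<le> downs p (int (length p))"
    using downs_mono[of "x + y + 1" "int (length p)" p] downs_beyond[of p "x + y + 1"] by linarith
  then obtain m where m: "m < length p" "p ! m = Down" "downs p (int m) = x"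
    using R downs_attained[of p 0 x] by auto
  then have "int m < x + y + 1" using R downs_mono[of "x + y + 1" "int m" p] by linarith
  then show "cell_above p (x, y)"
    using m by (auto simp: cell_above_def vertex_downs intro!: exI[of _ m])
qed

text \<open>On each antidiagonal the region is the interval between the vertices of the two paths.\<close>

lemma skew_region_downs:
  assumes "downs \<mu> (int (length \<mu>)) = downs \<nu> (int (length \<nu>))"
  shows "(x, y) \<in> skew_region \<nu> \<mu> \<longleftrightarrow> downs \<mu> (x + y + 1) \<le> x \<and> x < downs \<nu> (x + y + 1)"
proof -
  have "downs \<nu> (x + y + 1) \<le> downs \<nu> (int (length \<nu>))"
    using downs_mono[of "x + y + 1" "int (length \<nu>)" \<nu>] downs_beyond[of \<nu> "x + y + 1"] by linarith
  moreover have "0 \<le> downs \<mu> (x + y + 1)" by simp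
  ultimately show ?thesis
    unfolding skew_region_def by (auto simp: cell_below_downs cell_above_downs assms simp del: downs_nonneg)
qed

lemma weakly_above_downs:
  assumes "downs \<mu> (int (length \<mu>)) = downs \<nu> (int (length \<nu>))" "length \<mu> = length \<nu>"
  shows "weakly_above \<mu> \<nu> \<longleftrightarrow> (\<forall>i. downs \<mu> i \<le> downs \<nu> i)"
proof
  assume W: "weakly_above \<mu> \<nu>"
  show "\<forall>i. downs \<mu> i \<le> downs \<nu> i"
  proof
    fix i
    let ?x = "downs \<nu> i"
    show "downs \<mu> i \<le> ?x"
    proof (cases "?x < downs \<nu> (int (length \<nu>))")
      case True
      have "cell_below \<nu> (?x, i - 1 - ?x)" using True by (auto simp: cell_below_downs)
      then have "cell_below \<mu> (?x, i - 1 - ?x)" using W by (auto simp: weakly_above_def)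
      then show ?thesis by (auto simp: cell_below_downs)
    next
      case False
      have "downs \<mu> i \<le> downs \<mu> (int (length \<mu>))"
        using downs_mono[of i "int (length \<mu>)" \<mu>] downs_beyond[of \<mu> i] by linarith
      then show ?thesis using False assms by linarith
    qed
  qed
next
  assume "\<forall>i. downs \<mu> i \<le> downs \<nu> i"
  then show "weakly_above \<mu> \<nu>"
    unfolding weakly_above_def using assms(1) by (auto simp: cell_below_downs intro: order_trans)
qed

section \<open>Cover-inclusive sets of tiles\<close>

text \<open>For upper paths only the endpoint is recorded: such a path is \<open>k\<close>-Dyck as soon as it is weakly above
  a \<open>k\<close>-Dyck path.\<close>

definition path_to :: "nat \<Rightarrow> nat \<Rightarrow> step list \<Rightarrow> bool" where
  "path_to k n p \<longleftrightarrow> length p = (k + 1) * n \<and> downs p (int (length p)) = int (k * n)"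

lemma kdyck_path_to: "kdyck_path k n p \<Longrightarrow> path_to k n p"
  unfolding kdyck_path_downs path_to_def by (elim conjE, intro conjI)

text \<open>The conditions on a tiling that do not mention the lower path. For a tile of the region, lying below
  the lower path after the translation by \<open>(1, -1)\<close> means leaving the region.\<close>

definition cover_inclusive :: "nat \<Rightarrow> cell set set \<Rightarrow> bool" where
  "cover_inclusive k D \<longleftrightarrow>
     (\<forall>\<eta>\<in>D. kdyck_tile k \<eta>) \<and>
     (\<forall>\<eta>\<in>D. \<forall>\<theta>\<in>D. \<eta> \<noteq> \<theta> \<longrightarrow> \<eta> \<inter> \<theta> = {}) \<and>
     (\<forall>\<eta>\<in>D. translate (1, -1) \<eta> \<inter> \<Union>D = {} \<or> (\<exists>\<theta>\<in>D. translate (1, -1) \<eta> \<subseteq> \<theta>))"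

lemma cover_inclusiveI:
  assumes "\<And>\<eta>. \<eta> \<in> D \<Longrightarrow> kdyck_tile k \<eta>"
    and "\<And>\<eta> \<theta>. \<eta> \<in> D \<Longrightarrow> \<theta> \<in> D \<Longrightarrow> \<eta> \<noteq> \<theta> \<Longrightarrow> \<eta> \<inter> \<theta> = {}"
    and "\<And>\<eta>. \<eta> \<in> D \<Longrightarrow>
      translate (1, -1) \<eta> \<inter> \<Union>D = {} \<or> (\<exists>\<theta>\<in>D. translate (1, -1) \<eta> \<subseteq> \<theta>)"
  shows "cover_inclusive k D"
  unfolding cover_inclusive_def by (intro conjI ballI impI; rule assms; assumption)

lemma cover_inclusiveD:
  assumes "cover_inclusive k D" "\<eta> \<in> D"
  shows "kdyck_tile k \<eta>"
    and "\<theta> \<in> D \<Longrightarrow> \<eta> \<noteq> \<theta> \<Longrightarrow> \<eta> \<inter> \<theta> = {}"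
    and "translate (1, -1) \<eta> \<inter> \<Union>D = {} \<or> (\<exists>\<theta>\<in>D. translate (1, -1) \<eta> \<subseteq> \<theta>)"
  using assms unfolding cover_inclusive_def by simp_all

lemma mem_translate: "(x, y) \<in> translate (a, b) \<eta> \<longleftrightarrow> (x - a, y - b) \<in> \<eta>"
  by (auto simp: translate_def intro!: image_eqI[where x = "(x - a, y - b)"])

lemma mem_tile:
  "(x, y) \<in> translate (a, b) (vertices p) \<longleftrightarrow>
     a + b \<le> x + y \<and> x + y \<le> a + b + int (length p) \<and> x = a + downs p (x + y - a - b)"
proof -
  have e: "x - a + (y - b) = x + y - a - b" by simp
  show ?thesis unfolding mem_translate vertices_downs e by auto
qed

lemma kdyck_tileE:
  assumes "kdyck_tile k \<eta>"
  obtains m p a b where "kdyck_path k m p" "\<eta> = translate (a, b) (vertices p)"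
proof -
  obtain m p v where "kdyck_path k m p" "\<eta> = translate v (vertices p)"
    using assms unfolding kdyck_tile_def by blast
  then show thesis using that by (cases v) auto
qed

lemma kdyck_tileI: "kdyck_path k m p \<Longrightarrow> kdyck_tile k (translate (a, b) (vertices p))"
  unfolding kdyck_tile_def by (intro exI conjI) (auto)

lemma kdyck_tile_nonempty:
  assumes "kdyck_tile k \<eta>"
  obtains x y where "(x, y) \<in> \<eta>"
proof -
  obtain m p a b where "\<eta> = translate (a, b) (vertices p)" using kdyck_tileE[OF assms] .
  then have "(a, b) \<in> \<eta>" by (simp add: mem_tile)
  then show thesis by (rule that)
qed

lemma kdyck_tile_single: "kdyck_tile k {(x, y)}"
proof -
  have "kdyck_path k 0 []" by (simp add: kdyck_path_def vertex_def)
  moreover have "translate (x, y) (vertices []) = {(x, y)}"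
    by (auto simp: vertices_def vertex_def translate_def)
  ultimately show ?thesis by (metis kdyck_tileI)
qed

text \<open>In particular, no tile contains its own translate by \<open>(1, -1)\<close>.\<close>

lemma kdyck_tile_antidiagonal:
  assumes "kdyck_tile k \<eta>" "(x, y) \<in> \<eta>" "(x', y') \<in> \<eta>" "x + y = x' + y'"
  shows "x = x'"
proof -
  obtain m p a b where "\<eta> = translate (a, b) (vertices p)" using kdyck_tileE[OF assms(1)] .
  then show ?thesis using assms by (simp add: mem_tile)
qed

lemma kdyck_tiling_iff:
  assumes k: "k \<ge> 1" and nu: "kdyck_path k n \<nu>" and mu: "path_to k n \<mu>"
  shows "kdyck_tiling k \<nu> \<mu> D \<longleftrightarrow> cover_inclusive k D \<and> \<Union>D = skew_region \<nu> \<mu>"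
proof -
  note nu' = nu[unfolded kdyck_path_downs]
  have tot: "downs \<mu> (int (length \<mu>)) = downs \<nu> (int (length \<nu>))"
    using mu nu' unfolding path_to_def by metis
  have below: "cell_below \<nu> (x + 1, y - 1) \<longleftrightarrow> (x + 1, y - 1) \<notin> skew_region \<nu> \<mu>"
    if "(x, y) \<in> skew_region \<nu> \<mu>" for x y
  proof -
    define i where "i = x + y + 1"
    have xy: "downs \<mu> i \<le> x" "x < downs \<nu> i"
      using that unfolding skew_region_downs[OF tot] i_def by auto
    have x0: "0 \<le> x" using xy(1) downs_nonneg[of \<mu> i] by linarith
    \<comment> \<open>The translated cell must still lie in a column of the grid: a \<open>k\<close>-Dyck path reaches its
        final abscissa only at its endpoint, where both paths coincide.\<close>
    have "x + 1 < int (k * n)" if "downs \<nu> i \<le> x + 1"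
    proof (rule ccontr)
      assume neg: "\<not> ?thesis"
      have i: "i < int (length \<mu>)"
      proof (rule ccontr)
        assume "\<not> ?thesis"
        then have "downs \<mu> i = int (k * n)" "downs \<nu> i = int (k * n)"
          using downs_beyond[of \<mu> i] downs_beyond[of \<nu> i] mu nu' by (auto simp: path_to_def)
        then show False using xy by linarith
      qed
      have i': "i \<le> int (length \<nu>)" "0 \<le> i"
        using i mu nu' xy x0 downs_nonpos[of i \<nu>] by (auto simp: path_to_def intro: ccontr)
      then have "(int k + 1) * downs \<nu> i \<le> int k * i" using nu' by simp
      moreover have "downs \<nu> i = int (k * n)"
        using neg xy downs_mono[OF i'(1), of \<nu>] nu' that by linarith
      ultimately have "int k * ((int k + 1) * int n) \<le> int k * i" by (simp add: algebra_simps)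
      then have "(int k + 1) * int n \<le> i" using k by simp
      then show False using i mu by (simp add: path_to_def algebra_simps)
    qed
    then show ?thesis using xy x0 nu' unfolding cell_below_downs skew_region_downs[OF tot]
      by (auto simp: i_def)
  qed
  have "(\<forall>c\<in>translate (1, -1) \<eta>. cell_below \<nu> c) \<longleftrightarrow> translate (1, -1) \<eta> \<inter> \<Union>D = {}"
    if "\<Union>D = skew_region \<nu> \<mu>" "\<eta> \<in> D" for \<eta>
    using that below by (fastforce simp: translate_def)
  moreover have "\<theta> \<noteq> \<eta>"
    if tile: "kdyck_tile k \<eta>" and sub: "translate (1, -1) \<eta> \<subseteq> \<theta>" for \<eta> \<theta>
  proof
    assume "\<theta> = \<eta>"
    obtain x y where xy: "(x, y) \<in> \<eta>" by (rule kdyck_tile_nonempty[OF tile])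
    have "(x + 1, y - 1) \<in> \<eta>" using xy sub \<open>\<theta> = \<eta>\<close> mem_translate[of "x + 1" "y - 1" 1 "-1" \<eta>] by auto
    then show False using kdyck_tile_antidiagonal[OF tile xy] by fastforce
  qed
  ultimately show ?thesis
    unfolding kdyck_tiling_def cover_inclusive_def by (smt (verit))
qed

lemma mem_tilings_above:
  assumes "k \<ge> 1" "path_to k n \<mu>"
  shows "D \<in> kdyck_tilings_above k n \<mu> \<longleftrightarrow> cover_inclusive k D \<and>
     (\<exists>\<nu>. kdyck_path k n \<nu> \<and> (\<forall>i. downs \<mu> i \<le> downs \<nu> i) \<and> \<Union>D = skew_region \<nu> \<mu>)"
proof -
  have "weakly_above \<mu> \<nu> \<longleftrightarrow> (\<forall>i. downs \<mu> i \<le> downs \<nu> i)" if "kdyck_path k n \<nu>" for \<nu>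
    using weakly_above_downs[of \<mu> \<nu>] assms(2) kdyck_path_to[OF that] unfolding path_to_def by metis
  then show ?thesis
    unfolding kdyck_tilings_above_def using kdyck_tiling_iff[OF assms(1) _ assms(2)] by auto
qed

section \<open>Inserting a peak along an antidiagonal\<close>

definition insert_peak :: "nat \<Rightarrow> nat \<Rightarrow> step list \<Rightarrow> step list" where
  "insert_peak k s p = take s p @ Up # replicate k Down @ drop s p"

lemma length_insert_peak [simp]: "s \<le> length p \<Longrightarrow> length (insert_peak k s p) = length p + k + 1"
  by (simp add: insert_peak_def)

lemma count_list_replicate: "count_list (replicate m a) b = (if a = b then m else 0)"
  by (induction m) auto

text \<open>Here \<open>j\<close> is the number of inserted down steps among the first \<open>i\<close> steps. The minimum treats the
  inserted steps and the shifted tail alike, and \<open>squash\<close> below uses the same expression.\<close>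

lemma downs_insert_peak:
  assumes "s \<le> length p"
  shows "downs (insert_peak k s p) i =
    (if i \<le> int s then downs p i
     else let j = min (int k) (i - 1 - int s) in downs p (i - 1 - j) + j)"
proof -
  consider "i \<le> int s" | j where "i = int (s + 1 + j)" "j \<le> k" | e where "i = int (s + 1 + k + e)"
  proof -
    assume a: "i \<le> int s \<Longrightarrow> thesis" "\<And>j. i = int (s + 1 + j) \<Longrightarrow> j \<le> k \<Longrightarrow> thesis"
      "\<And>e. i = int (s + 1 + k + e) \<Longrightarrow> thesis"
    show thesis
    proof (cases "i \<le> int s")
      case False
      show thesis
      proof (cases "i \<le> int (s + 1 + k)")
        case True
        then show thesis using False by (intro a(2)[of "nat i - s - 1"]) auto
      next
        case F: False
        then show thesis by (intro a(3)[of "nat i - s - 1 - k"]) auto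
      qed
    qed (rule a(1))
  qed
  then show ?thesis
  proof cases
    case 1
    then have "nat i \<le> s" by linarith
    then show ?thesis using 1 assms by (simp add: downs_def insert_peak_def)
  next
    case 2
    have n: "nat i = s + 1 + j" using 2 by simp
    show ?thesis using 2 assms
      unfolding downs_def n by (simp add: insert_peak_def count_list_replicate Let_def)
  next
    case 3
    have n: "nat i = s + 1 + k + e" using 3 by simp
    have n': "nat (i - 1 - int k) = s + e" using 3 by simp
    have m: "min (int k) (i - 1 - int s) = int k" "\<not> i \<le> int s" using 3 by auto
    have "count_list (take (s + 1 + k + e) (insert_peak k s p)) Down = count_list (take (s + e) p) Down + k"
      using assms by (simp add: insert_peak_def count_list_replicate take_add)
    then show ?thesis unfolding m Let_def using m(2)
      unfolding downs_def n n' by simp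
  qed
qed

lemma path_to_insert_peak:
  assumes "s \<le> length p"
  shows "path_to k (Suc n) (insert_peak k s p) \<longleftrightarrow> path_to k n p"
proof -
  have e: "int (length p + k + 1) = int (length p) + int k + 1"
      "int (k * Suc n) = int (k * n) + int k" by simp_all
  have "\<not> int (length p) + int k + 1 \<le> int s" "min (int k) (int (length p) + int k + 1 - 1 - int s) = int k"
    using assms by auto
  then have d: "downs (insert_peak k s p) (int (length p) + int k + 1) = downs p (int (length p)) + int k"
    unfolding downs_insert_peak[OF assms] by (simp add: Let_def)
  show ?thesis unfolding path_to_def length_insert_peak[OF assms] e d by auto
qed

lemma kdyck_path_insert_peak:
  assumes s: "s \<le> length p"
  shows "kdyck_path k (Suc n) (insert_peak k s p) \<longleftrightarrow> kdyck_path k n p"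
proof -
  have "(\<forall>i. 0 \<le> i \<and> i \<le> int (length (insert_peak k s p)) \<longrightarrow>
            (int k + 1) * downs (insert_peak k s p) i \<le> int k * i) \<longleftrightarrow>
        (\<forall>i. 0 \<le> i \<and> i \<le> int (length p) \<longrightarrow> (int k + 1) * downs p i \<le> int k * i)"
    (is "?L = ?R")
  proof
    assume L: ?L
    show ?R
    proof (intro allI impI)
      fix i assume i: "0 \<le> i \<and> i \<le> int (length p)"
      show "(int k + 1) * downs p i \<le> int k * i"
      proof (cases "i \<le> int s")
        case True
        then show ?thesis using L[rule_format, of i] i s by (simp add: downs_insert_peak)
      next
        case False
        then have "downs (insert_peak k s p) (i + int k + 1) = downs p i + int k"
          using s by (simp add: downs_insert_peak)
        then show ?thesis using L[rule_format, of "i + int k + 1"] i s by (simp add: algebra_simps)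
      qed
    qed
  next
    assume R: ?R
    show ?L
    proof (intro allI impI)
      fix i assume i: "0 \<le> i \<and> i \<le> int (length (insert_peak k s p))"
      show "(int k + 1) * downs (insert_peak k s p) i \<le> int k * i"
      proof (cases "i \<le> int s")
        case True
        then show ?thesis using R i s by (simp add: downs_insert_peak)
      next
        case False
        define j where "j = min (int k) (i - 1 - int s)"
        have j: "j \<le> int k" "0 \<le> i - 1 - j" "i - 1 - j \<le> int (length p)"
          using False i s by (auto simp: j_def)
        have "downs (insert_peak k s p) i = downs p (i - 1 - j) + j"
          using False s by (simp add: downs_insert_peak j_def Let_def)
        moreover have "(int k + 1) * downs p (i - 1 - j) \<le> int k * (i - 1 - j)" using R j by blast
        ultimately show ?thesis using j by (simp add: algebra_simps)
      qed
    qed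
  qed
  then show ?thesis
    using path_to_insert_peak[OF s, of k n] unfolding kdyck_path_downs path_to_def by blast
qed

lemma insert_peak_remove:
  assumes "s + k + 1 \<le> length p"
    and "\<And>j. 0 \<le> j \<Longrightarrow> j \<le> int k \<Longrightarrow> downs p (int s + 1 + j) = downs p (int s) + j"
  shows "p = insert_peak k s (take s p @ drop (s + k + 1) p)"
proof -
  have U: "p ! s = Up"
    using assms(1) assms(2)[of 0] downs_Suc[of s p] by (cases "p ! s") auto
  have D: "p ! (s + 1 + j) = Down" if "j < k" for j
    using assms(1) assms(2)[of "int j"] assms(2)[of "int j + 1"] downs_Suc[of "s + 1 + j" p] that
    by (auto simp: algebra_simps split: if_splits)
  have "take (k + 1) (drop s p) = Up # replicate k Down"
  proof (rule nth_equalityI)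
    show "length (take (k + 1) (drop s p)) = length (Up # replicate k Down)" using assms(1) by simp
    fix i assume "i < length (take (k + 1) (drop s p))"
    then show "take (k + 1) (drop s p) ! i = (Up # replicate k Down) ! i"
      using U D[of "i - 1"] assms(1) by (cases i) auto
  qed
  moreover have "drop (k + 1) (drop s p) = drop (s + k + 1) p" by (simp add: add.commute)
  ultimately have "drop s p = (Up # replicate k Down) @ drop (s + k + 1) p"
    by (metis append_take_drop_id)
  then have "p = take s p @ (Up # replicate k Down) @ drop (s + k + 1) p"
    by (metis append_take_drop_id)
  then show ?thesis using assms(1) by (simp add: insert_peak_def)
qed

text \<open>The antidiagonals \<open>s, \<dots>, s + k\<close> are collapsed onto \<open>s - 1\<close>, and everything beyond them moves by
  \<open>(-k, -1)\<close>. The fibre over a cell on the antidiagonal \<open>s - 1\<close> consists of this cell and of the cells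
  reached from it by an up step and up to \<open>k\<close> down steps. Hence taking preimages inserts the steps
  \<open>U D^k\<close> into every path of cells that meets this antidiagonal.\<close>

definition squash :: "nat \<Rightarrow> int \<Rightarrow> cell \<Rightarrow> cell" where
  "squash k s = (\<lambda>(x, y). if x + y < s then (x, y) else (x - min (int k) (x + y - s), y - 1))"

lemma surj_squash: "surj (squash k s)"
proof -
  have "squash k s (if x + y < s then (x, y) else (x + int k, y + 1)) = (x, y)" for x y
    by (auto simp: squash_def)
  then show ?thesis by (intro surjI[where f = "\<lambda>(x, y). if x + y < s then (x, y) else (x + int k, y + 1)"]) auto
qed

lemma vimage_squash_inject: "squash k s -` A = squash k s -` B \<longleftrightarrow> A = B"
proof
  assume "squash k s -` A = squash k s -` B"
  then have "squash k s ` (squash k s -` A) = squash k s ` (squash k s -` B)" by simp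
  then show "A = B" by (simp only: surj_image_vimage_eq[OF surj_squash])
qed simp

lemma vimage_squash_translate:
  "squash k s -` translate (1, -1) \<eta> = translate (1, -1) (squash k s -` \<eta>)"
proof -
  have "squash k s (x, y) \<in> translate (1, -1) \<eta> \<longleftrightarrow> squash k s (x - 1, y + 1) \<in> \<eta>" for x y
    by (auto simp: squash_def mem_translate algebra_simps)
  then have "squash k s (x, y) \<in> translate (1, -1) \<eta> \<longleftrightarrow> (x, y) \<in> translate (1, -1) (squash k s -` \<eta>)" for x y
    by (simp add: mem_translate)
  then show ?thesis by (intro set_eqI) (metis surj_pair vimage_eq)
qed

text \<open>A cell moves horizontally exactly as far as the path does on its antidiagonal, so \<open>squash\<close>
  preserves the side of the path on which a cell lies.\<close>

lemma downs_insert_peak_squash: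
  assumes "s \<le> length p" "squash k (int s) (x, y) = (x', y')"
  shows "downs (insert_peak k s p) (x + y + 1) - x = downs p (x' + y' + 1) - x'"
proof (cases "x + y < int s")
  case True
  then show ?thesis using assms by (auto simp: downs_insert_peak squash_def)
next
  case False
  define j where "j = min (int k) (x + y - int s)"
  have "x' = x - j" "y' = y - 1" using assms(2) False by (auto simp: squash_def j_def)
  moreover have "downs (insert_peak k s p) (x + y + 1) = downs p (x + y - j) + j"
    using False assms(1) by (simp add: downs_insert_peak j_def Let_def)
  moreover have "x - j + (y - 1) + 1 = x + y - j" by simp
  ultimately show ?thesis by (simp only:)
qed

lemma vimage_squash_skew_region:
  assumes "s \<le> length \<mu>" "path_to k n \<mu>" "path_to k n \<nu>"
  shows "squash k (int s) -` skew_region \<nu> \<mu> = skew_region (insert_peak k s \<nu>) (insert_peak k s \<mu>)"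
proof -
  have s: "s \<le> length \<nu>" using assms by (simp add: path_to_def)
  have p: "path_to k (Suc n) (insert_peak k s \<mu>)" "path_to k (Suc n) (insert_peak k s \<nu>)"
    using assms s by (auto simp: path_to_insert_peak)
  have 1: "downs \<mu> (int (length \<mu>)) = downs \<nu> (int (length \<nu>))"
    using assms unfolding path_to_def by metis
  have 2: "downs (insert_peak k s \<mu>) (int (length (insert_peak k s \<mu>))) =
      downs (insert_peak k s \<nu>) (int (length (insert_peak k s \<nu>)))"
    using p unfolding path_to_def by metis
  have "squash k (int s) (x, y) \<in> skew_region \<nu> \<mu> \<longleftrightarrow>
      (x, y) \<in> skew_region (insert_peak k s \<nu>) (insert_peak k s \<mu>)" for x y
  proof -
    obtain x' y' where q: "squash k (int s) (x, y) = (x', y')" by (metis surj_pair)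
    show ?thesis
      unfolding skew_region_downs[OF 1] skew_region_downs[OF 2] q
      using downs_insert_peak_squash[OF assms(1) q] downs_insert_peak_squash[OF s q] by linarith
  qed
  then show ?thesis by (intro set_eqI) (metis surj_pair vimage_eq)
qed

text \<open>A tile lies beyond the antidiagonal \<open>s - 1\<close>, lies before it, or meets it. Only in the last case
  its shape changes.\<close>

lemma vimage_squash_tile_right:
  assumes "s \<le> a + b"
  shows "squash k s -` translate (a, b) (vertices p) = translate (a + int k, b + 1) (vertices p)"
proof -
  have "squash k s (x, y) \<in> translate (a, b) (vertices p) \<longleftrightarrow>
     (x, y) \<in> translate (a + int k, b + 1) (vertices p)" for x y
    using assms unfolding squash_def by (auto simp: mem_tile min_def algebra_simps)
  then show ?thesis by (intro set_eqI) (metis surj_pair vimage_eq)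
qed

lemma vimage_squash_tile_left:
  assumes "a + b + int (length p) < s - 1"
  shows "squash k s -` translate (a, b) (vertices p) = translate (a, b) (vertices p)"
proof -
  have "squash k s (x, y) \<in> translate (a, b) (vertices p) \<longleftrightarrow>
     (x, y) \<in> translate (a, b) (vertices p)" for x y
    using assms unfolding squash_def by (auto simp: mem_tile min_def algebra_simps)
  then show ?thesis by (intro set_eqI) (metis surj_pair vimage_eq)
qed

lemma vimage_squash_tile_cut:
  assumes "a + b + int l = s - 1" "l \<le> length p"
  shows "squash k s -` translate (a, b) (vertices p) = translate (a, b) (vertices (insert_peak k l p))"
proof -
  have "squash k s (x, y) \<in> translate (a, b) (vertices p) \<longleftrightarrow>
     (x, y) \<in> translate (a, b) (vertices (insert_peak k l p))" for x y
  proof (cases "x + y < s")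
    case True
    then show ?thesis
      using assms by (auto simp: squash_def mem_tile downs_insert_peak)
  next
    case False
    define j where "j = min (int k) (x + y - s)"
    have j: "j \<le> int k" "j \<le> x + y - s" "j = int k \<or> j = x + y - s" by (auto simp: j_def)
    have j': "min (int k) (x + y - a - b - 1 - int l) = j" using assms by (simp add: j_def)
    have "\<not> x + y - a - b \<le> int l" using False assms by simp
    then have D: "downs (insert_peak k l p) (x + y - a - b) = downs p (x + y - a - b - 1 - j) + j"
      using assms(2) by (simp add: downs_insert_peak Let_def j')
    have i: "x - j + (y - 1) - a - b = x + y - a - b - 1 - j" by simp
    have q: "squash k s (x, y) = (x - j, y - 1)" using False by (simp add: squash_def j_def)
    define w where "w = downs p (x + y - a - b - 1 - j)"
    have len: "int (length p + k + 1) = int (length p) + int k + 1" by simp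
    have l: "int l \<le> int (length p)" using assms(2) by simp
    from j(3) show ?thesis unfolding q mem_tile D i length_insert_peak[OF assms(2)] w_def[symmetric] len
      by (elim disjE; intro iffI; elim conjE; intro conjI; use j(1,2) l False assms(1) in linarith)
  qed
  then show ?thesis by (intro set_eqI) (metis surj_pair vimage_eq)
qed

text \<open>If a preimage is a tile that meets the antidiagonal \<open>s - 1\<close>, then it contains a whole fibre, so its
  path has the steps \<open>U D^k\<close> there; deleting them leaves a \<open>k\<close>-Dyck path, which traces \<open>\<eta>\<close>.\<close>

lemma kdyck_tile_vimage_squash: "kdyck_tile k (squash k s -` \<eta>) \<longleftrightarrow> kdyck_tile k \<eta>"
proof
  assume "kdyck_tile k \<eta>"
  then obtain m p a b where p: "kdyck_path k m p" and e: "\<eta> = translate (a, b) (vertices p)"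
    by (rule kdyck_tileE)
  consider "s \<le> a + b" | "a + b + int (length p) < s - 1"
    | "a + b + int (nat (s - 1 - a - b)) = s - 1" "nat (s - 1 - a - b) \<le> length p" by linarith
  then show "kdyck_tile k (squash k s -` \<eta>)"
  proof cases
    case 1
    then show ?thesis using p unfolding e by (simp add: vimage_squash_tile_right kdyck_tileI)
  next
    case 2
    then show ?thesis using p unfolding e by (simp add: vimage_squash_tile_left kdyck_tileI)
  next
    case 3
    then show ?thesis using p kdyck_path_insert_peak[OF 3(2), of k m]
      unfolding e vimage_squash_tile_cut[OF 3] by (blast intro: kdyck_tileI)
  qed
next
  assume "kdyck_tile k (squash k s -` \<eta>)"
  then obtain m p a b where p: "kdyck_path k m p"
      and e: "squash k s -` \<eta> = translate (a, b) (vertices p)"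
    by (rule kdyck_tileE)
  have sat: "c' \<in> translate (a, b) (vertices p)"
    if "c \<in> translate (a, b) (vertices p)" "squash k s c = squash k s c'" for c c'
    using that unfolding e[symmetric] by simp
  consider "s \<le> a + b" | "a + b + int (length p) < s - 1"
    | "a + b + int (nat (s - 1 - a - b)) = s - 1" "nat (s - 1 - a - b) \<le> length p" by linarith
  then show "kdyck_tile k \<eta>"
  proof cases
    case 1
    have "s + int k < a + b"
    proof (rule ccontr)
      assume n: "\<not> ?thesis"
      have "(a - (a + b - s), b - 1) \<in> translate (a, b) (vertices p)"
        by (rule sat[of "(a, b)"]) (use 1 n in \<open>auto simp: mem_tile squash_def\<close>)
      then show False using 1 unfolding mem_tile by linarith
    qed
    then have "squash k s -` translate (a - int k, b - 1) (vertices p) = squash k s -` \<eta>"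
      unfolding e by (subst vimage_squash_tile_right) auto
    then show ?thesis using p unfolding vimage_squash_inject by (metis kdyck_tileI)
  next
    case 2
    then have "squash k s -` translate (a, b) (vertices p) = squash k s -` \<eta>"
      unfolding e by (rule vimage_squash_tile_left)
    then show ?thesis using p unfolding vimage_squash_inject by (metis kdyck_tileI)
  next
    case 3
    define l where "l = nat (s - 1 - a - b)"
    have l: "a + b + int l = s - 1" "l \<le> length p" using 3 by (auto simp: l_def)
    define x y where "x = a + downs p (int l)" and "y = s - 1 - x"
    have xy: "(x, y) \<in> translate (a, b) (vertices p)"
    proof -
      have "x + y - a - b = int l" using l by (simp add: y_def)
      then show ?thesis unfolding mem_tile using l by (simp add: x_def)
    qed
    have peak: "int l + 1 + j \<le> int (length p) \<and> downs p (int l + 1 + j) = downs p (int l) + j"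
      if "0 \<le> j" "j \<le> int k" for j
    proof -
      have "(x + j, y + 1) \<in> translate (a, b) (vertices p)"
        by (rule sat[OF xy]) (use that in \<open>auto simp: squash_def y_def\<close>)
      moreover have e2: "x + j + (y + 1) - a - b = int l + 1 + j" using l by (simp add: y_def)
      ultimately have "x + j = a + downs p (int l + 1 + j)" "x + j + (y + 1) \<le> a + b + int (length p)"
        unfolding mem_tile e2 by blast+
      then show ?thesis using e2 unfolding x_def by linarith
    qed
    define p' where "p' = take l p @ drop (l + k + 1) p"
    have len: "l + k + 1 \<le> length p" using peak[of "int k"] by simp
    have pp: "p = insert_peak k l p'"
      unfolding p'_def by (rule insert_peak_remove) (use len peak in auto)
    have lp: "l \<le> length p'" using len by (simp add: p'_def)
    have "m \<noteq> 0" using p len unfolding kdyck_path_downs by (metis add_is_0 le_zero_eq mult_0_right one_neq_zero)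
    then obtain m' where m': "m = Suc m'" by (cases m) auto
    have "kdyck_path k m' p'" using p kdyck_path_insert_peak[OF lp] unfolding pp m' by blast
    moreover have "squash k s -` translate (a, b) (vertices p') = squash k s -` \<eta>"
      unfolding e vimage_squash_tile_cut[OF l(1) lp] pp[symmetric] ..
    ultimately show ?thesis unfolding vimage_squash_inject by (metis kdyck_tileI)
  qed
qed

text \<open>Apart from the shape of the tiles, the conditions are relations between sets of cells. Preimages
  under the surjection \<open>squash\<close> preserve and reflect these, and \<open>squash\<close> commutes with the translation
  by \<open>(1, -1)\<close>.\<close>

lemma cover_inclusive_vimage_squash:
  "cover_inclusive k (vimage (squash k s) ` D) \<longleftrightarrow> cover_inclusive k D"
proof -
  let ?v = "vimage (squash k s)"
  have U: "\<Union>(?v ` D) = ?v (\<Union>D)" by blast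
  have e: "?v A = {} \<longleftrightarrow> A = {}" for A using vimage_squash_inject[of k s A "{}"] by simp
  have i: "?v A \<inter> ?v B = ?v (A \<inter> B)" for A B by blast
  have sub: "?v A \<subseteq> ?v B \<longleftrightarrow> A \<subseteq> B" for A B
    using vimage_squash_inject[of k s "A \<inter> B" A] unfolding vimage_Int[symmetric] by blast
  show ?thesis
    unfolding cover_inclusive_def U ball_simps bex_simps
      vimage_squash_translate[symmetric] i e sub kdyck_tile_vimage_squash vimage_squash_inject
    by simp
qed

lemma spread_mem_tilings_above:
  assumes k: "k \<ge> 1" and mu: "path_to k n \<mu>" and s: "s \<le> length \<mu>"
    and D: "D \<in> kdyck_tilings_above k n \<mu>"
  shows "vimage (squash k (int s)) ` D \<in> kdyck_tilings_above k (Suc n) (insert_peak k s \<mu>)"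
proof -
  obtain \<nu> where \<nu>: "cover_inclusive k D" "kdyck_path k n \<nu>" "\<And>i. downs \<mu> i \<le> downs \<nu> i"
      "\<Union>D = skew_region \<nu> \<mu>"
    using D unfolding mem_tilings_above[OF k mu] by blast
  have s': "s \<le> length \<nu>" using s mu kdyck_path_to[OF \<nu>(2)] by (simp add: path_to_def)
  have "\<Union>(vimage (squash k (int s)) ` D) = squash k (int s) -` skew_region \<nu> \<mu>"
    unfolding \<nu>(4)[symmetric] by blast
  also have "\<dots> = skew_region (insert_peak k s \<nu>) (insert_peak k s \<mu>)"
    by (rule vimage_squash_skew_region[OF s mu kdyck_path_to[OF \<nu>(2)]])
  finally have "\<Union>(vimage (squash k (int s)) ` D) = skew_region (insert_peak k s \<nu>) (insert_peak k s \<mu>)" .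
  moreover have "downs (insert_peak k s \<mu>) i \<le> downs (insert_peak k s \<nu>) i" for i
    using \<nu>(3) s s' by (simp add: downs_insert_peak Let_def)
  moreover have "path_to k (Suc n) (insert_peak k s \<mu>)" "kdyck_path k (Suc n) (insert_peak k s \<nu>)"
    using mu s s' \<nu>(2) by (auto simp: path_to_insert_peak kdyck_path_insert_peak)
  ultimately show ?thesis
    using \<nu>(1) unfolding mem_tilings_above[OF k \<open>path_to k (Suc n) (insert_peak k s \<mu>)\<close>]
      cover_inclusive_vimage_squash by blast
qed


section \<open>Adding a top row\<close>

text \<open>The path \<open>base\<close> ends with a run of \<open>r\<close> down steps after \<open>q\<close>. The path \<open>peak t\<close> has one more up step,
  placed \<open>t\<close> steps into this run and followed by \<open>k\<close> additional down steps, so all paths \<open>peak t\<close>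
  agree outside the new top row. The tilings below \<open>peak 0\<close> are to be reduced to those below \<open>base\<close>.\<close>

locale last_run =
  fixes k n :: nat and q :: "step list" and r :: nat
  assumes k_pos: "k \<ge> 1" and path_to_base: "path_to k n (q @ replicate r Down)"
begin

definition base :: "step list" where
  "base = q @ replicate r Down"

definition u :: int where
  "u = downs q (int (length q))"

definition peak :: "nat \<Rightarrow> step list" where
  "peak t = insert_peak k (length q + t) base"

lemma base: "path_to k n base"
  using path_to_base by (simp only: base_def)

lemma downs_base:
  "downs base i = (if i \<le> int (length q) then downs q i else u + min (int r) (i - int (length q)))"
proof (cases "i \<le> int (length q)")
  case True
  then show ?thesis by (simp add: downs_def base_def nat_le_iff)
next
  case False
  then have n: "nat i = length q + nat (i - int (length q))" by simp
  have "min r (nat (i - int (length q))) = nat (min (int r) (i - int (length q)))" by auto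
  then show ?thesis using False unfolding downs_def base_def u_def n
    by (simp add: count_list_replicate)
qed

lemma length_q: "int (length q) = int n + u" and u_r: "u + int r = int k * int n" and u_nonneg: "0 \<le> u"
proof -
  have l: "length base = length q + r" by (simp add: base_def)
  have "downs base (int (length q + r)) = u + int r" by (auto simp: downs_base u_def)
  then show 1: "u + int r = int k * int n" using base l unfolding path_to_def by simp
  have "length q + r = (k + 1) * n" using base l unfolding path_to_def by simp
  then have "int (length q) + int r = int k * int n + int n"
    by (simp flip: of_nat_add of_nat_mult)
  then show "int (length q) = int n + u" using 1 by linarith
  show "0 \<le> u" by (simp add: u_def)
qed

lemma path_to_peak: "t \<le> r \<Longrightarrow> path_to k (Suc n) (peak t)"
  unfolding peak_def using base by (simp add: path_to_insert_peak base_def)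

lemma downs_peak:
  assumes "t \<le> r"
  shows "downs (peak t) i = (if i \<le> int (length q) then downs q i
     else if i \<le> int (length q) + int t then u + (i - int (length q))
     else u + min (int r + int k) (i - int (length q) - 1))"
proof -
  have t: "length q + t \<le> length base" using assms by (simp add: base_def)
  have run: "downs base i = u + min (int r) (i - int (length q))" if "int (length q) \<le> i" for i
    using that by (auto simp: downs_base u_def)
  show ?thesis
  proof (cases "i \<le> int (length q) + int t")
    case True
    then show ?thesis
      unfolding peak_def downs_insert_peak[OF t] using assms by (auto simp: downs_base)
  next
    case False
    define j where "j = min (int k) (i - 1 - int (length q) - int t)"
    have "int (length q) \<le> i - 1 - j" "int (length q + t) = int (length q) + int t"
        "min (int r) (i - 1 - j - int (length q)) + j = min (int r + int k) (i - int (length q) - 1)"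
      using False assms by (auto simp: j_def)
    then show ?thesis
      unfolding peak_def downs_insert_peak[OF t] using False by (simp add: run j_def Let_def)
  qed
qed

lemma downs_peak_at: "t \<le> r \<Longrightarrow> downs (peak t) (int (length q) + int t) = u + int t"
  by (auto simp: downs_peak u_def)

lemma downs_peak_after:
  assumes "t \<le> r" "0 \<le> j" "j \<le> int k"
  shows "downs (peak t) (int (length q) + int t + 1 + j) = u + int t + j"
  using assms by (auto simp: downs_peak u_def)

lemma mem_region:
  assumes "t \<le> r" "kdyck_path k (Suc n) \<nu>"
  shows "(x, y) \<in> skew_region \<nu> (peak t) \<longleftrightarrow> downs (peak t) (x + y + 1) \<le> x \<and> x < downs \<nu> (x + y + 1)"
  by (rule skew_region_downs)
    (use path_to_peak[OF assms(1)] kdyck_path_to[OF assms(2)] in \<open>metis path_to_def\<close>)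

text \<open>The path \<open>peak t\<close> has only \<open>n + 1\<close> up steps.\<close>

lemma row_le:
  assumes "t \<le> r" "kdyck_path k (Suc n) \<nu>" "(x, y) \<in> skew_region \<nu> (peak t)"
  shows "y \<le> int n"
proof -
  have r: "downs (peak t) (x + y + 1) \<le> x" "x < downs \<nu> (x + y + 1)"
    using assms(3) by (auto simp: mem_region[OF assms(1,2)])
  define L where "L = int ((k + 1) * Suc n)"
  have L: "downs (peak t) L = int (k * Suc n)" "downs \<nu> L = int (k * Suc n)"
      "length (peak t) = (k + 1) * Suc n" "length \<nu> = (k + 1) * Suc n"
    using path_to_peak[OF assms(1)] kdyck_path_to[OF assms(2)] unfolding path_to_def L_def by metis+
  have "x + y + 1 \<le> L"
  proof (rule ccontr)
    assume "\<not> ?thesis"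
    then have "downs (peak t) (x + y + 1) = downs \<nu> (x + y + 1)"
      using downs_beyond[of "peak t" "x + y + 1"] downs_beyond[of \<nu> "x + y + 1"] L by (simp add: L_def)
    then show False using r by simp
  qed
  then have "int (k * Suc n) \<le> x + (L - (x + y + 1))"
    using downs_lipschitz[of "x + y + 1" L "peak t"] r L by linarith
  then show ?thesis by (simp add: L_def algebra_simps)
qed

definition singles :: "nat \<Rightarrow> cell set set" where
  "singles t = (\<lambda>j. {(u + int j, int n)}) ` {..<t}"

lemma card_singles: "card (singles t) = t" and finite_singles: "finite (singles t)"
  unfolding singles_def by (auto simp: card_image inj_on_def)

lemma Union_singles: "(x, y) \<in> \<Union>(singles t) \<longleftrightarrow> y = int n \<and> u \<le> x \<and> x < u + int t"
proof
  assume "y = int n \<and> u \<le> x \<and> x < u + int t"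
  then have "{(x, y)} = {(u + int (nat (x - u)), int n)}" "nat (x - u) < t" by auto
  then show "(x, y) \<in> \<Union>(singles t)" unfolding singles_def by blast
qed (auto simp: singles_def)

lemma peak_0_le: "t \<le> r \<Longrightarrow> downs (peak 0) i \<le> downs (peak t) i"
  by (auto simp: downs_peak)

text \<open>The cells between \<open>peak t\<close> and \<open>peak 0\<close> are the first \<open>t\<close> cells of the top row.\<close>

lemma region_peak_0:
  assumes t: "t \<le> r" and \<nu>: "kdyck_path k (Suc n) \<nu>" "\<And>i. downs (peak t) i \<le> downs \<nu> i"
  shows "skew_region \<nu> (peak 0) = skew_region \<nu> (peak t) \<union> \<Union>(singles t)"
    and "skew_region \<nu> (peak t) \<inter> \<Union>(singles t) = {}"
proof -
  have strip: "(x, y) \<in> \<Union>(singles t) \<longleftrightarrow> downs (peak 0) (x + y + 1) \<le> x \<and> x < downs (peak t) (x + y + 1)"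
    for x y
    unfolding Union_singles using t length_q by (auto simp: downs_peak min_def)
  have "(x, y) \<in> skew_region \<nu> (peak 0) \<longleftrightarrow> (x, y) \<in> skew_region \<nu> (peak t) \<union> \<Union>(singles t)" for x y
    unfolding Un_iff strip mem_region[OF t \<nu>(1)] mem_region[OF le0 \<nu>(1)]
    using \<nu>(2)[of "x + y + 1"] peak_0_le[OF t, of "x + y + 1"] by linarith
  then show "skew_region \<nu> (peak 0) = skew_region \<nu> (peak t) \<union> \<Union>(singles t)" by auto
  show "skew_region \<nu> (peak t) \<inter> \<Union>(singles t) = {}"
  proof -
    have "\<not> ((x, y) \<in> skew_region \<nu> (peak t) \<and> (x, y) \<in> \<Union>(singles t))" for x y
      unfolding strip mem_region[OF t \<nu>(1)] by linarith
    then show ?thesis by auto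
  qed
qed

text \<open>The translation moves cells down, out of the top row.\<close>

lemma translate_avoids_singles:
  assumes \<nu>: "kdyck_path k (Suc n) \<nu>" and \<eta>: "\<eta> \<subseteq> skew_region \<nu> (peak 0)"
  shows "translate (1, -1) \<eta> \<inter> \<Union>(singles t) = {}"
proof -
  have "(x, y) \<notin> \<Union>(singles t)" if "(x, y) \<in> translate (1, -1) \<eta>" for x y
  proof -
    have "(x - 1, y + 1) \<in> skew_region \<nu> (peak 0)"
      using that \<eta> unfolding mem_translate by auto
    then have "y + 1 \<le> int n" by (rule row_le[OF le0 \<nu>])
    then show ?thesis unfolding Union_singles by simp
  qed
  then show ?thesis by auto
qed

text \<open>The translate of a single cell is a single cell, hence contained in a tile as soon as it meets one.\<close>

lemma add_singles:
  assumes t: "t \<le> r" and D: "D \<in> kdyck_tilings_above k (Suc n) (peak t)"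
  shows "D \<union> singles t \<in> kdyck_tilings_above k (Suc n) (peak 0)" and "D \<inter> singles t = {}"
proof -
  obtain \<nu> where ci: "cover_inclusive k D" and \<nu>: "kdyck_path k (Suc n) \<nu>"
      "\<And>i. downs (peak t) i \<le> downs \<nu> i" and U: "\<Union>D = skew_region \<nu> (peak t)"
    using D unfolding mem_tilings_above[OF k_pos path_to_peak[OF t]] by blast
  note reg = region_peak_0[OF t \<nu>, folded U]
  show "D \<inter> singles t = {}"
  proof (rule ccontr)
    assume "D \<inter> singles t \<noteq> {}"
    then obtain \<eta> where "\<eta> \<in> D" "\<eta> \<in> singles t" by blast
    moreover from this have "\<eta> \<noteq> {}" by (auto simp: singles_def)
    ultimately show False using reg(2) by blast
  qed
  have "cover_inclusive k (D \<union> singles t)"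
  proof (rule cover_inclusiveI)
    fix \<eta> assume "\<eta> \<in> D \<union> singles t"
    then show "kdyck_tile k \<eta>"
      using cover_inclusiveD(1)[OF ci] unfolding singles_def by (auto simp: kdyck_tile_single)
  next
    fix \<eta> \<theta> assume *: "\<eta> \<in> D \<union> singles t" "\<theta> \<in> D \<union> singles t" "\<eta> \<noteq> \<theta>"
    have "\<eta> \<inter> \<theta> = {}" if "\<eta> \<in> singles t" "\<theta> \<in> singles t"
      using that *(3) by (auto simp: singles_def)
    moreover have "\<eta> \<inter> \<theta> = {}" if "\<eta> \<in> D" "\<theta> \<in> D"
      using that *(3) by (rule cover_inclusiveD(2)[OF ci])
    ultimately show "\<eta> \<inter> \<theta> = {}" using *(1,2) reg(2) by blast
  next
    fix \<eta> assume \<eta>: "\<eta> \<in> D \<union> singles t"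
    then have no: "translate (1, -1) \<eta> \<inter> \<Union>(singles t) = {}"
      using reg(1) by (intro translate_avoids_singles[OF \<nu>(1)]) auto
    show "translate (1, -1) \<eta> \<inter> \<Union>(D \<union> singles t) = {} \<or>
        (\<exists>\<theta>\<in>D \<union> singles t. translate (1, -1) \<eta> \<subseteq> \<theta>)"
    proof (cases "\<eta> \<in> D")
      case True
      from cover_inclusiveD(3)[OF ci this] show ?thesis
      proof
        assume "translate (1, -1) \<eta> \<inter> \<Union>D = {}"
        then show ?thesis using no unfolding Union_Un_distrib by blast
      qed (rule disjI2, blast)
    next
      case False
      then obtain c where "\<eta> = {c}" using \<eta> by (auto simp: singles_def)
      then obtain c' where "translate (1, -1) \<eta> = {c'}" by (auto simp: translate_def)
      then show ?thesis using no unfolding Union_Un_distrib by (cases "c' \<in> \<Union>D") auto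
    qed
  qed
  moreover have "\<Union>(D \<union> singles t) = skew_region \<nu> (peak 0)" using reg(1) by blast
  moreover have "downs (peak 0) i \<le> downs \<nu> i" for i
    using \<nu>(2)[of i] peak_0_le[OF t, of i] by linarith
  ultimately show "D \<union> singles t \<in> kdyck_tilings_above k (Suc n) (peak 0)"
    unfolding mem_tilings_above[OF k_pos path_to_peak[OF le0]] using \<nu>(1) by blast
qed

text \<open>The lower path is \<open>k\<close>-Dyck and thus takes its last up step at the abscissa \<open>k * n = u + r\<close> or
  before.\<close>

lemma single_bound:
  assumes D: "D \<in> kdyck_tilings_above k (Suc n) (peak 0)" and s: "{(u + int j, int n)} \<in> D"
  shows "j < r"
proof -
  obtain \<nu> where \<nu>: "kdyck_path k (Suc n) \<nu>" and U: "\<Union>D = skew_region \<nu> (peak 0)"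
    using D unfolding mem_tilings_above[OF k_pos path_to_peak[OF le0]] by blast
  define x i where "x = u + int j" and "i = x + int n + 1"
  have "(x, int n) \<in> skew_region \<nu> (peak 0)" using s U unfolding x_def by blast
  then have r: "downs (peak 0) i \<le> x" "x < downs \<nu> i"
    unfolding mem_region[OF le0 \<nu>] i_def by auto
  note K = \<nu>[unfolded kdyck_path_downs]
  have i0: "0 \<le> i" using u_nonneg by (simp add: i_def x_def)
  have "i \<le> int (length \<nu>)"
  proof (rule ccontr)
    assume "\<not> ?thesis"
    moreover have "length (peak 0) = length \<nu>" using path_to_peak[OF le0] K unfolding path_to_def by metis
    ultimately have "downs (peak 0) i = downs \<nu> i"
      using downs_beyond[of "peak 0" i] downs_beyond[of \<nu> i] K path_to_peak[OF le0]
      unfolding path_to_def by auto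
    then show False using r by simp
  qed
  then have "(int k + 1) * downs \<nu> i \<le> int k * i" using K i0 by blast
  moreover have "(int k + 1) * (x + 1) \<le> (int k + 1) * downs \<nu> i" using r(2) by (intro mult_left_mono) auto
  ultimately have "(int k + 1) * (x + 1) \<le> int k * i" by linarith
  then have "x + 1 \<le> int k * int n" by (simp add: i_def algebra_simps)
  then show ?thesis using u_r unfolding x_def by linarith
qed

lemma remove_singles:
  assumes D: "D \<in> kdyck_tilings_above k (Suc n) (peak 0)" and s: "singles t \<subseteq> D" and t: "t \<le> r"
  shows "D - singles t \<in> kdyck_tilings_above k (Suc n) (peak t)"
proof -
  obtain \<nu> where ci: "cover_inclusive k D" and \<nu>: "kdyck_path k (Suc n) \<nu>"
      "\<And>i. downs (peak 0) i \<le> downs \<nu> i" and U: "\<Union>D = skew_region \<nu> (peak 0)"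
    using D unfolding mem_tilings_above[OF k_pos path_to_peak[OF le0]] by blast
  have le: "downs (peak t) i \<le> downs \<nu> i" for i
  proof (cases "int (length q) < i \<and> i \<le> int (length q) + int t")
    case True
    then have "(i - int n - 1, int n) \<in> \<Union>(singles t)"
      unfolding Union_singles using length_q by linarith
    then have "(i - int n - 1, int n) \<in> \<Union>D" using s by blast
    then have "i - int n - 1 < downs \<nu> i" unfolding U mem_region[OF le0 \<nu>(1)] by simp
    then show ?thesis using True t length_q by (simp add: downs_peak)
  next
    case False
    then have "downs (peak t) i = downs (peak 0) i" using t by (auto simp: downs_peak)
    then show ?thesis using \<nu>(2) by simp
  qed
  note reg = region_peak_0[OF t \<nu>(1) le]
  have disj: "\<eta> \<inter> \<theta> = {}" if "\<eta> \<in> D" "\<theta> \<in> D" "\<eta> \<noteq> \<theta>" for \<eta> \<theta>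
    using that by (rule cover_inclusiveD(2)[OF ci])
  have "\<Union>(D - singles t) = \<Union>D - \<Union>(singles t)" using s disj by fast
  then have U': "\<Union>(D - singles t) = skew_region \<nu> (peak t)" using U reg by blast
  have "cover_inclusive k (D - singles t)"
  proof (rule cover_inclusiveI)
    fix \<eta> assume \<eta>: "\<eta> \<in> D - singles t"
    then show tile: "kdyck_tile k \<eta>" using cover_inclusiveD(1)[OF ci] by simp
    have no: "translate (1, -1) \<eta> \<inter> \<Union>(singles t) = {}"
      using \<eta> U by (intro translate_avoids_singles[OF \<nu>(1)]) auto
    obtain x y where "(x, y) \<in> \<eta>" by (rule kdyck_tile_nonempty[OF tile])
    then have ne: "translate (1, -1) \<eta> \<noteq> {}" by (auto simp: translate_def)
    have "translate (1, -1) \<eta> \<inter> \<Union>D = {} \<or> (\<exists>\<theta>\<in>D. translate (1, -1) \<eta> \<subseteq> \<theta>)"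
      using \<eta> by (intro cover_inclusiveD(3)[OF ci]) simp
    then show "translate (1, -1) \<eta> \<inter> \<Union>(D - singles t) = {} \<or>
        (\<exists>\<theta>\<in>D - singles t. translate (1, -1) \<eta> \<subseteq> \<theta>)"
    proof
      assume "translate (1, -1) \<eta> \<inter> \<Union>D = {}"
      then show ?thesis by blast
    next
      assume "\<exists>\<theta>\<in>D. translate (1, -1) \<eta> \<subseteq> \<theta>"
      then obtain \<theta> where "\<theta> \<in> D" "translate (1, -1) \<eta> \<subseteq> \<theta>" by blast
      moreover from this(2) have "\<theta> \<notin> singles t" using no ne by blast
      ultimately show ?thesis by blast
    qed
  next
    fix \<eta> \<theta> assume "\<eta> \<in> D - singles t" "\<theta> \<in> D - singles t" "\<eta> \<noteq> \<theta>"
    then show "\<eta> \<inter> \<theta> = {}" by (intro disj) auto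
  qed
  then show ?thesis
    unfolding mem_tilings_above[OF k_pos path_to_peak[OF t]] using \<nu>(1) le U' by blast
qed

text \<open>The pattern \<open>U D^k\<close> of cells that starts in column \<open>x\<close> on the antidiagonal of the cut.\<close>

definition fibre :: "nat \<Rightarrow> int \<Rightarrow> cell set" where
  "fibre t x = squash k (int (length q + t)) -` {(x, int (length q + t) - 1 - x)}"

lemma mem_fibre:
  "(x', y') \<in> fibre t x \<longleftrightarrow>
     (x' = x \<and> y' = int (length q + t) - 1 - x) \<or>
     (y' = int (length q + t) - x \<and> x \<le> x' \<and> x' \<le> x + int k)"
  unfolding fibre_def by (auto simp: squash_def)

lemma fibreI:
  "(x, int (length q + t) - 1 - x) \<in> fibre t x"
  "0 \<le> j \<Longrightarrow> j \<le> int k \<Longrightarrow> (x + j, int (length q + t) - x) \<in> fibre t x"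
  by (auto simp: mem_fibre)

lemma fibre_translate: "translate (1, -1) (fibre t x) = fibre t (x + 1)"
proof -
  have "translate (1, -1) {(x, y)} = {(x + 1, y - 1)}" for x y by (simp add: translate_def)
  then show ?thesis
    unfolding fibre_def vimage_squash_translate[symmetric] by (simp add: algebra_simps)
qed

lemma mem_region_fibre:
  assumes "t \<le> r" "kdyck_path k (Suc n) \<nu>" "u + int t \<le> x"
  shows "(x, int (length q + t) - 1 - x) \<in> skew_region \<nu> (peak t) \<longleftrightarrow>
      x < downs \<nu> (int (length q + t))"
    and "0 \<le> j \<Longrightarrow> j \<le> int k \<Longrightarrow> (x + j, int (length q + t) - x) \<in> skew_region \<nu> (peak t) \<longleftrightarrow>
      x + j < downs \<nu> (int (length q + t) + 1 + j)"
proof -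
  have e: "x + (int (length q + t) - 1 - x) + 1 = int (length q) + int t"
    "x + j + (int (length q + t) - x) + 1 = int (length q) + int t + 1 + j" by simp_all
  show "(x, int (length q + t) - 1 - x) \<in> skew_region \<nu> (peak t) \<longleftrightarrow>
      x < downs \<nu> (int (length q + t))"
    using downs_peak_at[OF assms(1)] assms(3) unfolding mem_region[OF assms(1,2)] e by simp
  show "(x + j, int (length q + t) - x) \<in> skew_region \<nu> (peak t) \<longleftrightarrow>
      x + j < downs \<nu> (int (length q + t) + 1 + j)" if "0 \<le> j" "j \<le> int k"
    using downs_peak_after[OF assms(1) that] assms(3) unfolding mem_region[OF assms(1,2)] e by simp
qed

text \<open>A cell in the top row of a tile that is neither the first cell nor has a left neighbour in the tile
  is entered by an up step. If the path of the tile has height \<open>m\<close>, then it has made at most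
  \<open>k * (m - 1)\<close> down steps before this up step, and \<open>k * m\<close> at its end, so at least \<open>k\<close> are to follow.\<close>

lemma tile_through_peak:
  assumes tile: "kdyck_tile k \<eta>" and c: "(x, y) \<in> \<eta>"
    and top: "\<And>x' y'. (x', y') \<in> \<eta> \<Longrightarrow> y' \<le> y"
    and left: "(x - 1, y) \<notin> \<eta>" and single: "\<eta> \<noteq> {(x, y)}"
  shows "(x, y - 1) \<in> \<eta>" and "0 \<le> j \<Longrightarrow> j \<le> int k \<Longrightarrow> (x + j, y) \<in> \<eta>"
proof -
  obtain m p a b where p: "kdyck_path k m p" and e: "\<eta> = translate (a, b) (vertices p)"
    using kdyck_tileE[OF tile] .
  note p' = p[unfolded kdyck_path_downs]
  have L: "int (length p) = (int k + 1) * int m" using p' by (simp add: algebra_simps)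
  have last: "downs p (int (length p)) = int k * int m" using p' unfolding of_nat_mult by blast
  define l w where "l = x + y - a - b" and "w = downs p l"
  have l: "0 \<le> l" "l \<le> int (length p)" and x: "x = a + w" and y: "y = b + l - w"
    using c unfolding e mem_tile l_def w_def by auto
  have cell: "(a + downs p i, b + i - downs p i) \<in> \<eta>" if "0 \<le> i" "i \<le> int (length p)" for i
    using that unfolding e mem_tile by (auto simp: algebra_simps)
  have "(a + int k * int m, b + int m) \<in> \<eta>"
    using cell[of "int (length p)"] last L by (simp add: algebra_simps)
  then have m: "int m \<le> l - w" using top y by fastforce
  have low: "i - int m \<le> downs p i" if "i \<le> int (length p)" for i
    using downs_lipschitz[OF that, of p] last L by (simp add: algebra_simps)
  have lw: "l - w = int m" using m low[OF l(2)] by (simp add: w_def)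
  have "l \<noteq> 0"
  proof
    assume "l = 0"
    then have "m = 0" "w = 0" using lw by (auto simp: w_def)
    then have "p = []" using p' by simp
    then have "\<eta> = {(a, b)}" unfolding e by (auto simp: vertices_def vertex_def translate_def)
    then show False using single c by simp
  qed
  then have l1: "0 \<le> l - 1" "l - 1 \<le> int (length p)" using l by auto
  have prev: "downs p (l - 1) = w"
  proof (rule ccontr)
    assume "\<not> ?thesis"
    then have "downs p (l - 1) = w - 1" using downs_step[of p "l - 1"] by (simp add: w_def)
    then have "a + downs p (l - 1) = x - 1" "b + (l - 1) - downs p (l - 1) = y" using x y by auto
    then show False using cell[OF l1] left by (simp only:)
  qed
  show "(x, y - 1) \<in> \<eta>"
  proof -
    have "a + downs p (l - 1) = x" "b + (l - 1) - downs p (l - 1) = y - 1" using x y prev by auto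
    then show ?thesis using cell[OF l1] by (simp only:)
  qed
  have "(int k + 1) * w \<le> int k * (l - 1)" using p' l1 prev by metis
  then have w: "w \<le> int k * (int m - 1)" unfolding lw[symmetric] by (simp add: algebra_simps)
  have "l + int k \<le> int (length p)" using w lw L by (simp add: algebra_simps)
  show "(x + j, y) \<in> \<eta>" if j: "0 \<le> j" "j \<le> int k"
  proof -
    have lj: "0 \<le> l + j" "l + j \<le> int (length p)" using j l \<open>l + int k \<le> int (length p)\<close> by auto
    have "downs p (l + j) = w + j"
      using low[OF lj(2)] downs_lipschitz[of l "l + j" p] j lw by (simp add: w_def)
    then have "a + downs p (l + j) = x + j" "b + (l + j) - downs p (l + j) = y" using x y by auto
    then show ?thesis using cell[OF lj] by (simp only:)
  qed
qed

text \<open>The fibres are translates of each other by \<open>(1, -1)\<close>. The one below the new peak is treated by the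
  shape of its tile, and cover-inclusiveness leads from each fibre to the next one.\<close>

lemma fibre_in_tile:
  assumes t: "t \<le> r" and ci: "cover_inclusive k D" and \<nu>: "kdyck_path k (Suc n) \<nu>"
    and le: "\<And>i. downs (peak t) i \<le> downs \<nu> i" and U: "\<Union>D = skew_region \<nu> (peak t)"
    and no_single: "{(u + int t, int n)} \<notin> D"
  shows "fibre t (u + int t + int m) \<inter> \<Union>D = {} \<or> (\<exists>\<eta>\<in>D. fibre t (u + int t + int m) \<subseteq> \<eta>)"
proof (induction m)
  case 0
  define s x where "s = int (length q + t)" and "x = u + int t"
  have sx: "s - x = int n" "s = int (length q) + int t" using length_q by (auto simp: s_def x_def)
  have x: "u + int t \<le> x" by (simp add: x_def)
  note reg = mem_region_fibre[OF t \<nu> x, folded s_def]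
  show ?case
  proof (cases "fibre t x \<inter> \<Union>D = {}")
    case False
    then obtain x' y' where c: "(x', y') \<in> fibre t x" "(x', y') \<in> skew_region \<nu> (peak t)"
      using U by auto
    have "x < downs \<nu> (s + 1)"
      using c(1) unfolding mem_fibre s_def[symmetric]
    proof
      assume "x' = x \<and> y' = s - 1 - x"
      then show ?thesis using c(2) reg(1) downs_mono[of s "s + 1" \<nu>] by auto
    next
      assume a: "y' = s - x \<and> x \<le> x' \<and> x' \<le> x + int k"
      then have "x' < downs \<nu> (s + 1 + (x' - x))" using c(2) reg(2)[of "x' - x"] by auto
      then show ?thesis using a downs_lipschitz[of "s + 1" "s + 1 + (x' - x)" \<nu>] by auto
    qed
    then have "(x, int n) \<in> \<Union>D" using reg(2)[of 0] U sx by simp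
    then obtain \<eta> where \<eta>: "\<eta> \<in> D" "(x, int n) \<in> \<eta>" by blast
    have sub: "\<eta> \<subseteq> skew_region \<nu> (peak t)" using \<eta>(1) U by blast
    have top: "y' \<le> int n" if "(x', y') \<in> \<eta>" for x' y'
      using row_le[OF t \<nu>] that sub by blast
    have "x - 1 + int n + 1 = int (length q) + int t" using sx by simp
    then have "(x - 1, int n) \<notin> skew_region \<nu> (peak t)"
      unfolding mem_region[OF t \<nu>] by (simp only: downs_peak_at[OF t]) (simp add: x_def)
    then have left: "(x - 1, int n) \<notin> \<eta>" using sub by blast
    have "\<eta> \<noteq> {(x, int n)}" using no_single \<eta>(1) by (auto simp: x_def)
    note through = tile_through_peak[OF cover_inclusiveD(1)[OF ci \<eta>(1)] \<eta>(2) _ left this]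
    have thr: "(x, int n - 1) \<in> \<eta>" "\<And>j. 0 \<le> j \<Longrightarrow> j \<le> int k \<Longrightarrow> (x + j, int n) \<in> \<eta>"
      by (rule through; use top in blast)+
    have "(x', y') \<in> \<eta>" if "(x', y') \<in> fibre t x" for x' y'
      using that unfolding mem_fibre s_def[symmetric]
    proof
      assume "x' = x \<and> y' = s - 1 - x"
      then have "x' = x" "y' = int n - 1" using sx by auto
      then show ?thesis using thr(1) by (simp only:)
    next
      assume "y' = s - x \<and> x \<le> x' \<and> x' \<le> x + int k"
      then show ?thesis using thr(2)[of "x' - x"] sx by simp
    qed
    then have "fibre t x \<subseteq> \<eta>" by auto
    then show ?thesis using \<eta>(1) by (auto simp: x_def)
  qed (simp add: x_def)
next
  case (Suc m)
  define s x where "s = int (length q + t)" and "x = u + int t + int m"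
  have x: "u + int t \<le> x" "u + int t \<le> x + 1" by (auto simp: x_def)
  have x1: "u + int t + int (Suc m) = x + 1" by (simp add: x_def)
  note reg = mem_region_fibre[OF t \<nu> x(1), folded s_def] mem_region_fibre[OF t \<nu> x(2), folded s_def]
  from Suc.IH[folded x_def]
  have "fibre t (x + 1) \<inter> \<Union>D = {} \<or> (\<exists>\<eta>\<in>D. fibre t (x + 1) \<subseteq> \<eta>)"
  proof
    assume a: "fibre t x \<inter> \<Union>D = {}"
    have "(x, s - 1 - x) \<notin> \<Union>D" using a fibreI(1)[of x t] unfolding s_def by blast
    then have b1: "downs \<nu> s \<le> x" using reg(1) U by simp
    have b2: "downs \<nu> (s + 1 + j) \<le> x + j" if "0 \<le> j" "j \<le> int k" for j
    proof -
      have "(x + j, s - x) \<notin> \<Union>D" using a fibreI(2)[OF that, of x t] unfolding s_def by blast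
      then show ?thesis using reg(2)[OF that] U by simp
    qed
    have "(x', y') \<notin> \<Union>D" if "(x', y') \<in> fibre t (x + 1)" for x' y'
      using that unfolding mem_fibre s_def[symmetric]
    proof
      assume c: "x' = x + 1 \<and> y' = s - 1 - (x + 1)"
      then show ?thesis using b1 reg(3) U by simp
    next
      assume c: "y' = s - (x + 1) \<and> x + 1 \<le> x' \<and> x' \<le> x + 1 + int k"
      then show ?thesis using b2[of "x' - (x + 1)"] reg(4)[of "x' - (x + 1)"] U by simp
    qed
    then show ?thesis by (intro disjI1 equals0I) (auto simp del: Union_iff)
  next
    assume "\<exists>\<eta>\<in>D. fibre t x \<subseteq> \<eta>"
    then obtain \<eta> where \<eta>: "\<eta> \<in> D" "fibre t x \<subseteq> \<eta>" by blast
    have "fibre t (x + 1) \<subseteq> translate (1, -1) \<eta>"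
      unfolding fibre_translate[symmetric] translate_def using \<eta>(2) by blast
    then show ?thesis using cover_inclusiveD(3)[OF ci \<eta>(1)] by blast
  qed
  then show ?case unfolding x1 .
qed

text \<open>By the preceding lemma all tiles are unions of fibres, hence preimages under \<open>squash\<close>. The
  lower path runs just below the last fibre contained in a tile and so has the steps \<open>U D^k\<close> as well.\<close>

lemma unspread:
  assumes t: "t \<le> r" and D: "D \<in> kdyck_tilings_above k (Suc n) (peak t)"
    and no_single: "{(u + int t, int n)} \<notin> D"
  obtains D' where "D' \<in> kdyck_tilings_above k n base"
    "D = vimage (squash k (int (length q + t))) ` D'"
proof -
  obtain \<nu> where ci: "cover_inclusive k D" and \<nu>: "kdyck_path k (Suc n) \<nu>"
      and le: "\<And>i. downs (peak t) i \<le> downs \<nu> i" and U: "\<Union>D = skew_region \<nu> (peak t)"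
    using D unfolding mem_tilings_above[OF k_pos path_to_peak[OF t]] by blast
  define s where "s = int (length q + t)"
  let ?sq = "squash k s"
  have fib: "fibre t x \<inter> \<Union>D = {} \<or> (\<exists>\<eta>\<in>D. fibre t x \<subseteq> \<eta>)" if "u + int t \<le> x" for x
    using fibre_in_tile[OF t ci \<nu> le U no_single, of "nat (x - (u + int t))"] that by simp
  have sat: "c' \<in> \<eta>" if \<eta>: "\<eta> \<in> D" and c: "c \<in> \<eta>" "?sq c = ?sq c'" for \<eta> c c'
  proof (cases "c = c'")
    case False
    obtain x1 y1 x2 y2 where cc: "c = (x1, y1)" "c' = (x2, y2)" by (cases c, cases c')
    have "\<exists>x. ?sq c = (x, s - 1 - x)"
      using False c(2) unfolding cc squash_def by (auto simp: min_def split: if_splits)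
    then obtain x where x: "?sq c = (x, s - 1 - x)" by blast
    then have f: "c \<in> fibre t x" "c' \<in> fibre t x"
      using c(2) unfolding fibre_def s_def by simp_all
    have "(x1, y1) \<in> skew_region \<nu> (peak t)" using \<eta> c(1) U cc by blast
    then have reg: "downs (peak t) (x1 + y1 + 1) \<le> x1" unfolding mem_region[OF t \<nu>] by simp
    have "u + int t \<le> x"
      using f(1) unfolding cc mem_fibre s_def[symmetric]
    proof
      assume a: "x1 = x \<and> y1 = s - 1 - x"
      then have "x1 + y1 + 1 = int (length q) + int t" by (simp add: s_def)
      then show ?thesis using reg a by (simp only: downs_peak_at[OF t])
    next
      assume a: "y1 = s - x \<and> x \<le> x1 \<and> x1 \<le> x + int k"
      then have "x1 + y1 + 1 = int (length q) + int t + 1 + (x1 - x)" by (simp add: s_def)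
      then have "downs (peak t) (x1 + y1 + 1) = u + int t + (x1 - x)"
        using a downs_peak_after[OF t, of "x1 - x"] by (simp only:) simp
      then show ?thesis using reg by simp
    qed
    then obtain \<theta> where \<theta>: "\<theta> \<in> D" "fibre t x \<subseteq> \<theta>" using fib f(1) \<eta> c(1) by blast
    then have "\<eta> = \<theta>" using cover_inclusiveD(2)[OF ci \<eta> \<theta>(1)] f(1) c(1) by blast
    then show ?thesis using \<theta>(2) f(2) by blast
  qed (use c in simp)
  define D' where "D' = image ?sq ` D"
  have inv: "?sq -` (?sq ` \<eta>) = \<eta>" if "\<eta> \<in> D" for \<eta>
  proof
    show "?sq -` (?sq ` \<eta>) \<subseteq> \<eta>"
    proof
      fix c assume "c \<in> ?sq -` (?sq ` \<eta>)"
      then obtain c0 where "c0 \<in> \<eta>" "?sq c0 = ?sq c" by auto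
      then show "c \<in> \<eta>" by (rule sat[OF that])
    qed
  qed blast
  have "(\<lambda>\<eta>. ?sq -` (?sq ` \<eta>)) ` D = id ` D" by (rule image_cong) (simp_all add: inv)
  then have DD: "D = vimage ?sq ` D'" unfolding D'_def image_image by simp
  have len\<nu>: "length \<nu> = (k + 1) * Suc n" using \<nu> by (simp add: kdyck_path_downs)
  have len: "length q + t + k + 1 \<le> length \<nu>"
  proof -
    have "int (length q + t) \<le> int n + int k * int n" using length_q u_r t by simp
    then have "int (length q + t + k + 1) \<le> int (length \<nu>)" unfolding len\<nu> by (simp add: algebra_simps)
    then show ?thesis by linarith
  qed
  have peak_\<nu>: "downs \<nu> (s + 1 + j) = downs \<nu> s + j" if j: "0 \<le> j" "j \<le> int k" for j
  proof -
    define x where "x = downs \<nu> s"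
    have x: "u + int t \<le> x"
      using le[of s] downs_peak_at[OF t] by (simp add: x_def s_def)
    have "(x, s - 1 - x) \<notin> \<Union>D" using mem_region_fibre(1)[OF t \<nu> x] U by (simp add: x_def s_def)
    then have "fibre t x \<inter> \<Union>D = {}" using fib[OF x] fibreI(1)[of x t] by (auto simp: s_def)
    then have "(x + j, s - x) \<notin> \<Union>D" using fibreI(2)[OF j, of x t] by (auto simp: s_def)
    then have 1: "downs \<nu> (s + 1 + j) \<le> x + j"
      using mem_region_fibre(2)[OF t \<nu> x j] U by (simp add: s_def)
    \<comment> \<open>the lower bound comes from the last fibre inside a tile, or from the upper path if no fibre
        is inside a tile\<close>
    have 2: "x + j \<le> downs \<nu> (s + 1 + j)"
    proof (cases "x = u + int t")
      case True
      then show ?thesis using le[of "s + 1 + j"] downs_peak_after[OF t j] by (simp add: s_def)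
    next
      case False
      then have x': "u + int t \<le> x - 1" using x by simp
      have "(x - 1, s - 1 - (x - 1)) \<in> \<Union>D"
        using mem_region_fibre(1)[OF t \<nu> x'] U by (simp add: x_def s_def)
      then obtain \<eta> where "\<eta> \<in> D" "fibre t (x - 1) \<subseteq> \<eta>"
        using fib[OF x'] fibreI(1)[of "x - 1" t] unfolding s_def by blast
      then have "(x - 1 + j, s - (x - 1)) \<in> \<Union>D"
        using fibreI(2)[OF j, of "x - 1" t] unfolding s_def by blast
      then show ?thesis using mem_region_fibre(2)[OF t \<nu> x' j] U by (simp add: s_def)
    qed
    show ?thesis using 1 2 by (simp add: x_def)
  qed
  define \<nu>' where "\<nu>' = take (length q + t) \<nu> @ drop (length q + t + k + 1) \<nu>"
  have \<nu>_eq: "\<nu> = insert_peak k (length q + t) \<nu>'"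
    unfolding \<nu>'_def by (rule insert_peak_remove[OF len]) (use peak_\<nu> in \<open>simp add: s_def\<close>)
  have s\<nu>': "length q + t \<le> length \<nu>'" using len by (simp add: \<nu>'_def)
  have sbase: "length q + t \<le> length base" using t by (simp add: base_def)
  have \<nu>': "kdyck_path k n \<nu>'" using \<nu> kdyck_path_insert_peak[OF s\<nu>'] \<nu>_eq by metis
  have "squash k (int (length q + t)) -` \<Union>D' = \<Union>D" unfolding DD s_def by blast
  also have "\<dots> = skew_region (insert_peak k (length q + t) \<nu>') (insert_peak k (length q + t) base)"
    using U \<nu>_eq by (simp add: peak_def)
  also have "\<dots> = squash k (int (length q + t)) -` skew_region \<nu>' base"
    by (rule vimage_squash_skew_region[OF sbase base kdyck_path_to[OF \<nu>'], symmetric])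
  finally have U': "\<Union>D' = skew_region \<nu>' base" unfolding vimage_squash_inject .
  have le': "downs base i \<le> downs \<nu>' i" for i
  proof (cases "i \<le> s")
    case True
    then show ?thesis using le[of i] unfolding peak_def
      by (subst (asm) \<nu>_eq) (simp add: downs_insert_peak[OF sbase] downs_insert_peak[OF s\<nu>'] s_def)
  next
    case False
    then have "downs (insert_peak k (length q + t) p) (i + int k + 1) = downs p i + int k"
      if "length q + t \<le> length p" for p
      unfolding downs_insert_peak[OF that] by (simp add: s_def Let_def)
    then show ?thesis using le[of "i + int k + 1"] sbase s\<nu>' unfolding peak_def
      by (subst (asm) \<nu>_eq) simp
  qed
  have "cover_inclusive k D'" using ci unfolding DD cover_inclusive_vimage_squash .
  then have "D' \<in> kdyck_tilings_above k n base"
    unfolding mem_tilings_above[OF k_pos base] using \<nu>' le' U' by blast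
  then show thesis using that DD unfolding s_def by blast
qed

lemma peak_0: "peak 0 = q @ Up # replicate (k + r) Down"
  by (simp add: peak_def base_def insert_peak_def replicate_add)

text \<open>The tiling is expanded \<open>t\<close> steps into the final run, and \<open>t\<close> single cells in the top row follow.\<close>

definition grow :: "cell set set \<times> nat \<Rightarrow> cell set set" where
  "grow = (\<lambda>(D, t). vimage (squash k (int (length q + t))) ` D \<union> singles t)"

lemma spread_mem:
  "t \<le> r \<Longrightarrow> D \<in> kdyck_tilings_above k n base \<Longrightarrow>
    vimage (squash k (int (length q + t))) ` D \<in> kdyck_tilings_above k (Suc n) (peak t)"
  unfolding peak_def by (rule spread_mem_tilings_above[OF k_pos base]) (simp add: base_def)

text \<open>The cell after the \<open>t\<close> single cells is never alone in its tile, since \<open>squash\<close> sends it and the cell below it to the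
  same cell.\<close>

lemma spread_no_single: "{(u + int t, int n)} \<notin> vimage (squash k (int (length q + t))) ` D"
proof
  let ?sq = "squash k (int (length q + t))"
  assume "{(u + int t, int n)} \<in> vimage ?sq ` D"
  then obtain \<eta> where \<eta>: "{(u + int t, int n)} = ?sq -` \<eta>" by blast
  have "?sq (u + int t, int n) = (u + int t, int n - 1)" "?sq (u + int t, int n - 1) = (u + int t, int n - 1)"
    using length_q by (simp_all add: squash_def)
  then have "(u + int t, int n - 1) \<in> ?sq -` \<eta>" using \<eta> by (metis insertI1 vimage_eq)
  then show False unfolding \<eta>[symmetric] by simp
qed

lemma mem_singles: "{(u + int j, int n)} \<in> singles t \<longleftrightarrow> j < t"
  by (auto simp: singles_def)

text \<open>The number \<open>t\<close> is recovered from the tiling as the length of the run of single tiles at the left end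
  of the top row, and expansion is inverted at the end of this run.\<close>

lemma bij_betw_grow:
  "bij_betw grow (kdyck_tilings_above k n base \<times> {..r}) (kdyck_tilings_above k (Suc n) (peak 0))"
  unfolding bij_betw_def
proof
  have next_single: "{(u + int j, int n)} \<in> grow (D, t) \<longleftrightarrow> j < t"
    if "j \<le> t" for D t j
    using that spread_no_single[of t D] mem_singles[of j t]
    by (cases "j = t") (auto simp: grow_def)
  show "inj_on grow (kdyck_tilings_above k n base \<times> {..r})"
  proof (rule inj_onI)
    fix x x'
    assume "x \<in> kdyck_tilings_above k n base \<times> {..r}" "x' \<in> kdyck_tilings_above k n base \<times> {..r}"
      and "grow x = grow x'"
    then obtain D t D' t' where x: "x = (D, t)" "x' = (D', t')"
      and D: "D \<in> kdyck_tilings_above k n base" "t \<in> {..r}"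
      and D': "D' \<in> kdyck_tilings_above k n base" "t' \<in> {..r}" and e: "grow (D, t) = grow (D', t')"
      by (cases x, cases x') auto
    have "t = t'"
    proof (rule linorder_cases)
      assume "t < t'"
      then show ?thesis using next_single[of t t D] next_single[of t t' D'] unfolding e by simp
    next
      assume "t' < t"
      then show ?thesis using next_single[of t' t' D'] next_single[of t' t D] unfolding e by simp
    qed
    let ?v = "vimage (squash k (int (length q + t)))"
    have "?v ` D \<inter> singles t = {}" "?v ` D' \<inter> singles t = {}"
      using add_singles(2)[OF _ spread_mem] D D' by auto
    moreover have "?v ` D \<union> singles t = ?v ` D' \<union> singles t"
      using e unfolding grow_def \<open>t = t'\<close> by simp
    moreover have "A = B" if "A \<inter> S = {}" "B \<inter> S = {}" "A \<union> S = B \<union> S" for A B S :: "cell set set"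
      using that by blast
    ultimately have "?v ` D = ?v ` D'" by metis
    moreover have "inj ?v" unfolding inj_def vimage_squash_inject by simp
    ultimately show "x = x'" using \<open>t = t'\<close> x by (simp add: inj_image_eq_iff)
  qed
  show "grow ` (kdyck_tilings_above k n base \<times> {..r}) = kdyck_tilings_above k (Suc n) (peak 0)"
  proof
    show "grow ` (kdyck_tilings_above k n base \<times> {..r}) \<subseteq> kdyck_tilings_above k (Suc n) (peak 0)"
    proof
      fix E assume "E \<in> grow ` (kdyck_tilings_above k n base \<times> {..r})"
      then obtain D t where "D \<in> kdyck_tilings_above k n base" "t \<le> r" "E = grow (D, t)" by auto
      then show "E \<in> kdyck_tilings_above k (Suc n) (peak 0)"
        using add_singles(1)[OF _ spread_mem] by (simp add: grow_def)
    qed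
    show "kdyck_tilings_above k (Suc n) (peak 0) \<subseteq> grow ` (kdyck_tilings_above k n base \<times> {..r})"
    proof
      fix D assume D: "D \<in> kdyck_tilings_above k (Suc n) (peak 0)"
      define t where "t = (LEAST j. {(u + int j, int n)} \<notin> D)"
      have ex: "{(u + int r, int n)} \<notin> D" using single_bound[OF D, of r] by auto
      have not: "{(u + int t, int n)} \<notin> D" unfolding t_def using ex by (rule LeastI)
      have t: "t \<le> r" unfolding t_def using ex by (rule Least_le)
      have sub: "singles t \<subseteq> D" unfolding singles_def t_def by (auto dest: not_less_Least)
      have "D - singles t \<in> kdyck_tilings_above k (Suc n) (peak t)"
        by (rule remove_singles[OF D sub t])
      then obtain D' where D': "D' \<in> kdyck_tilings_above k n base"
          "D - singles t = vimage (squash k (int (length q + t))) ` D'"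
        using not by (auto elim: unspread[OF t])
      have "D = grow (D', t)" unfolding grow_def using D'(2) sub by auto
      then show "D \<in> grow ` (kdyck_tilings_above k n base \<times> {..r})" using D'(1) t by blast
    qed
  qed
qed

lemma card_grow:
  assumes "t \<le> r" "D \<in> kdyck_tilings_above k n base" "finite D"
  shows "finite (grow (D, t))" "card (grow (D, t)) = card D + t"
proof -
  let ?v = "vimage (squash k (int (length q + t)))"
  have "inj ?v" unfolding inj_def vimage_squash_inject by simp
  then have "card (?v ` D) = card D" by (simp add: card_image inj_on_subset)
  then show "finite (grow (D, t))" "card (grow (D, t)) = card D + t"
    using add_singles(2)[OF assms(1) spread_mem[OF assms(1,2)]] assms(3) finite_singles[of t]
    by (auto simp: grow_def card_Un_disjoint card_singles)
qed

lemma tilings_generating_function: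
  assumes fin: "finite (kdyck_tilings_above k n base)"
    and fin': "\<And>D. D \<in> kdyck_tilings_above k n base \<Longrightarrow> finite D"
  shows "finite (kdyck_tilings_above k (Suc n) (peak 0))"
    and "\<And>D. D \<in> kdyck_tilings_above k (Suc n) (peak 0) \<Longrightarrow> finite D"
    and "(\<Sum>D\<in>kdyck_tilings_above k (Suc n) (peak 0). monom (1 :: int) (card D)) =
         (\<Sum>t\<le>r. monom 1 t) * (\<Sum>D\<in>kdyck_tilings_above k n base. monom 1 (card D))"
proof -
  let ?T = "kdyck_tilings_above k n base" and ?T' = "kdyck_tilings_above k (Suc n) (peak 0)"
  note bij = bij_betw_grow
  show "finite ?T'" using bij_betw_finite[OF bij] fin by simp
  show "finite D" if "D \<in> ?T'" for D
  proof -
    have "D \<in> grow ` (?T \<times> {..r})" using that bij by (simp add: bij_betw_def)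
    then show ?thesis using card_grow(1) fin' by auto
  qed
  have "(\<Sum>D\<in>?T'. monom (1 :: int) (card D)) = (\<Sum>x\<in>?T \<times> {..r}. monom 1 (card (grow x)))"
    by (rule sum.reindex_bij_betw[OF bij, symmetric])
  also have "\<dots> = (\<Sum>(D, t)\<in>?T \<times> {..r}. monom 1 (card D) * monom 1 t)"
    by (rule sum.cong) (auto simp: card_grow(2) fin' mult_monom)
  also have "\<dots> = (\<Sum>D\<in>?T. monom 1 (card D)) * (\<Sum>t\<le>r. monom 1 t)"
    by (simp add: sum_product sum.cartesian_product)
  finally show "(\<Sum>D\<in>?T'. monom (1 :: int) (card D)) =
         (\<Sum>t\<le>r. monom 1 t) * (\<Sum>D\<in>?T. monom 1 (card D))" by (simp add: mult.commute)
qed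

end

section \<open>Tilings below the boundary of a Ferrers diagram\<close>

text \<open>The boundary of the Ferrers diagram with row lengths \<open>c 1 \<ge> \<dots> \<ge> c n\<close>, running as \<open>alpha\<close> does.\<close>

definition board_path :: "nat \<Rightarrow> nat \<Rightarrow> (nat \<Rightarrow> nat) \<Rightarrow> step list" where
  "board_path k n c =
     concat (map (\<lambda>i. replicate (c i - c (i + 1)) Down @ [Up]) (rev [1..<n + 1]))
     @ replicate (k * n - c 1) Down"

lemma tilings_above_empty: "kdyck_tilings_above k 0 [] = {{}}" if "k \<ge> 1"
proof -
  have p: "path_to k 0 []" "kdyck_path k 0 []" by (simp_all add: path_to_def kdyck_path_downs)
  have r: "skew_region \<nu> [] = {}" if "kdyck_path k 0 \<nu>" for \<nu>
  proof -
    have "\<nu> = []" using that by (simp add: kdyck_path_downs)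
    then show ?thesis by (auto simp: skew_region_def cell_above_def)
  qed
  \<comment> \<open>tiles are nonempty\<close>
  have none: "D = {}" if "cover_inclusive k D" "\<Union>D = {}" for D
  proof (rule ccontr)
    assume "D \<noteq> {}"
    then obtain \<eta> where \<eta>: "\<eta> \<in> D" by blast
    show False using kdyck_tile_nonempty[OF cover_inclusiveD(1)[OF that(1) \<eta>]] that(2) \<eta> by blast
  qed
  have "cover_inclusive k {}" by (simp add: cover_inclusive_def)
  moreover have "\<exists>\<nu>. kdyck_path k 0 \<nu> \<and> (\<forall>i. downs [] i \<le> downs \<nu> i) \<and> \<Union>{} = skew_region \<nu> []"
    using p(2) r[OF p(2)] by (intro exI[of _ "[]"]) simp
  ultimately have "{} \<in> kdyck_tilings_above k 0 []"
    unfolding mem_tilings_above[OF that p(1)] by blast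
  moreover have "D = {}" if D: "D \<in> kdyck_tilings_above k 0 []" for D
    using D none r unfolding mem_tilings_above[OF \<open>k \<ge> 1\<close> p(1)] by metis
  ultimately show ?thesis by blast
qed

text \<open>Deleting the top row shifts the row lengths by one index and leaves a path that ends with
  \<open>k * (n - 1) - c 1\<close> down steps to the right of the place where the deleted row ended.\<close>

theorem tilings_of_board_path:
  assumes k: "k \<ge> 1"
    and "\<And>i. 1 \<le> i \<Longrightarrow> i \<le> n \<Longrightarrow> c (Suc i) \<le> c i \<and> c i \<le> k * (n - i)"
  shows "path_to k n (board_path k n c) \<and> finite (kdyck_tilings_above k n (board_path k n c)) \<and>
    (\<forall>D\<in>kdyck_tilings_above k n (board_path k n c). finite D) \<and>
    (\<Sum>D\<in>kdyck_tilings_above k n (board_path k n c). monom (1 :: int) (card D)) =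
      (\<Prod>i=1..n. \<Sum>t\<le>k * (n - i) - c i. monom 1 t)"
  using assms(2)
proof (induction n arbitrary: c)
  case 0
  then show ?case using tilings_above_empty[OF k] by (simp add: board_path_def path_to_def)
next
  case (Suc n)
  define q where "q = concat (map (\<lambda>i. replicate ((c \<circ> Suc) i - (c \<circ> Suc) (i + 1)) Down @ [Up])
      (rev [1..<n + 1])) @ replicate (c 1 - c 2) Down"
  define r where "r = k * n - c 1"
  have c1: "c 2 \<le> c 1" "c 1 \<le> k * n" using Suc.prems[of 1] by (auto simp: numeral_2_eq_2)
  have base_eq: "q @ replicate r Down = board_path k n (c \<circ> Suc)"
    using c1 by (simp add: q_def r_def board_path_def replicate_add[symmetric] numeral_2_eq_2)
  have IH: "path_to k n (board_path k n (c \<circ> Suc)) \<and> finite (kdyck_tilings_above k n (board_path k n (c \<circ> Suc))) \<and>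
    (\<forall>D\<in>kdyck_tilings_above k n (board_path k n (c \<circ> Suc)). finite D) \<and>
    (\<Sum>D\<in>kdyck_tilings_above k n (board_path k n (c \<circ> Suc)). monom (1 :: int) (card D)) =
      (\<Prod>i=1..n. \<Sum>t\<le>k * (n - i) - (c \<circ> Suc) i. monom 1 t)"
    by (rule Suc.IH) (use Suc.prems in force)
  interpret last_run k n q r
  proof unfold_locales
    show "path_to k n (q @ replicate r Down)" unfolding base_eq using IH by blast
  qed (rule k)
  have b: "base = board_path k n (c \<circ> Suc)" using base_eq by (simp only: base_def)
  have "rev [1..<Suc n + 1] = map Suc (rev [1..<n + 1]) @ [1]"
    by (simp add: rev_map[symmetric] map_Suc_upt upt_conv_Cons)
  then have "board_path k (Suc n) c = q @ Up # replicate (k + r) Down"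
    using c1 by (simp add: board_path_def q_def r_def comp_def numeral_2_eq_2 del: upt_Suc)
  then have pk: "board_path k (Suc n) c = peak 0" by (simp only: peak_0)
  have "(\<Prod>i=1..Suc n. \<Sum>t\<le>k * (Suc n - i) - c i. monom (1 :: int) t) =
      (\<Sum>t\<le>r. monom 1 t) * (\<Prod>i=1..n. \<Sum>t\<le>k * (n - i) - (c \<circ> Suc) i. monom 1 t)"
    unfolding r_def by (simp add: prod.atLeast_Suc_atMost prod.shift_bounds_cl_Suc_ivl del: prod.cl_ivl_Suc)
  then show ?case
    unfolding pk using IH tilings_generating_function path_to_peak[OF le0] unfolding b by simp
qed


section \<open>Inversion codes of Stirling permutations\<close>

text \<open>The length of row \<open>i\<close> of the inversion diagram, in a form that can be computed along a decomposition
  of the word.\<close>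

definition row_count :: "nat \<Rightarrow> nat list \<Rightarrow> nat" where
  "row_count i \<pi> = length (filter (\<lambda>x. i < x) (takeWhile (\<lambda>x. x \<noteq> i) \<pi>))"

definition stirling_word :: "nat list \<Rightarrow> bool" where
  "stirling_word \<pi> \<longleftrightarrow> (\<forall>a b c. a < b \<and> b < c \<and> c < length \<pi> \<and> \<pi> ! a = \<pi> ! c \<and> \<pi> ! b \<noteq> \<pi> ! a
     \<longrightarrow> \<pi> ! b < \<pi> ! a)"

lemma kstirling_iff:
  "\<pi> \<in> kstirling k n \<longleftrightarrow> mset \<pi> = (\<Sum>i\<in>{1..n}. replicate_mset k i) \<and> stirling_word \<pi>"
  unfolding kstirling_def stirling_word_def by simp

lemma stirling_wordD:
  "stirling_word \<pi> \<Longrightarrow> a < b \<Longrightarrow> b < c \<Longrightarrow> c < length \<pi> \<Longrightarrow> \<pi> ! a = w \<Longrightarrow> \<pi> ! c = w \<Longrightarrow> \<pi> ! b \<noteq> w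
    \<Longrightarrow> \<pi> ! b < w"
  unfolding stirling_word_def by metis

lemma set_kstirling:
  assumes "\<pi> \<in> kstirling k n" "k \<ge> 1"
  shows "set \<pi> = {1..n}"
proof -
  have "x \<in> set \<pi> \<longleftrightarrow> x \<in> {1..n}" for x
    using count_kstirling[OF assms(1), of x] assms(2) count_mset_0_iff[of \<pi> x] by (auto split: if_splits)
  then show ?thesis by blast
qed

lemma length_kstirling:
  assumes "\<pi> \<in> kstirling k n"
  shows "length \<pi> = k * n"
proof -
  have "length \<pi> = size (\<Sum>i\<in>{1..n}. replicate_mset k i)"
    using assms unfolding kstirling_iff by (metis size_mset)
  also have "\<dots> = k * n" by (induction n) auto
  finally show ?thesis .
qed

lemma inv_row_eq:
  assumes "\<pi> \<in> kstirling k n" "k \<ge> 1" "i \<in> {1..n}"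
  shows "inv_row n \<pi> i = row_count i \<pi>"
proof -
  define tw where "tw = takeWhile (\<lambda>x. x \<noteq> i) \<pi>"
  have nth: "tw ! j = \<pi> ! j" if "j < length tw" for j
    using that by (simp add: tw_def takeWhile_nth)
  have mem: "j < length tw \<longleftrightarrow> j < length \<pi> \<and> (\<forall>m\<le>j. \<pi> ! m \<noteq> i)" for j
  proof
    assume j: "j < length tw"
    have "\<pi> ! m \<noteq> i" if "m \<le> j" for m
    proof -
      have "tw ! m \<in> set tw" using j that by simp
      then show ?thesis using nth[of m] j that by (auto simp: tw_def dest: set_takeWhileD)
    qed
    moreover have "length tw \<le> length \<pi>" by (simp add: tw_def length_takeWhile_le)
    ultimately show "j < length \<pi> \<and> (\<forall>m\<le>j. \<pi> ! m \<noteq> i)" using j by simp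
  next
    assume j: "j < length \<pi> \<and> (\<forall>m\<le>j. \<pi> ! m \<noteq> i)"
    show "j < length tw"
    proof (rule ccontr)
      assume "\<not> ?thesis"
      then have "length tw < length \<pi>" "length tw \<le> j" using j by auto
      then show False using nth_length_takeWhile[of "\<lambda>x. x \<noteq> i" \<pi>] j by (auto simp: tw_def)
    qed
  qed
  have "{j. (i, j) \<in> INVk n \<pi>} = {j. j < length tw \<and> i < tw ! j}"
    using assms(3) nth mem unfolding INVk_iff[OF assms(1,2)] by auto
  then show ?thesis
    unfolding inv_row_def row_count_def tw_def by (simp add: length_filter_conv_card)
qed

lemma invk_eq: "invk n \<pi> = (\<Sum>i=1..n. inv_row n \<pi> i)"
proof -
  have "INVk n \<pi> = (SIGMA i:{1..n}. {j. (i, j) \<in> INVk n \<pi>})" by (auto simp: INVk_def)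
  then have "invk n \<pi> = card (SIGMA i:{1..n}. {j. (i, j) \<in> INVk n \<pi>})"
    unfolding invk_def by (rule arg_cong)
  moreover have "finite {j. (i, j) \<in> INVk n \<pi>}" for i
    by (rule finite_subset[of _ "{..<length \<pi>}"]) (auto simp: INVk_def)
  ultimately show ?thesis unfolding inv_row_def by (simp add: card_SigmaI)
qed

definition insert_ones :: "nat \<Rightarrow> nat \<Rightarrow> nat list \<Rightarrow> nat list" where
  "insert_ones k p \<pi> = take p (map Suc \<pi>) @ replicate k 1 @ drop p (map Suc \<pi>)"

text \<open>All letters in front of the block exceed 1, and the block contributes to no other entry.\<close>

lemma row_count_insert_ones:
  assumes "p \<le> length \<pi>" "0 \<notin> set \<pi>" "k \<ge> 1"
  shows "row_count 1 (insert_ones k p \<pi>) = p"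
    and "i \<ge> 1 \<Longrightarrow> row_count (Suc i) (insert_ones k p \<pi>) = row_count i \<pi>"
proof -
  let ?xs = "take p (map Suc \<pi>)" and ?ys = "drop p (map Suc \<pi>)"
  obtain k' where k: "k = Suc k'" using assms(3) by (cases k) auto
  have gt: "1 < x" if "x \<in> set ?xs" for x
    using that assms(2) by (auto dest!: in_set_takeD) (metis gr0I)
  have "takeWhile (\<lambda>x. x \<noteq> 1) (insert_ones k p \<pi>) = ?xs"
    unfolding insert_ones_def using gt by (subst takeWhile_append2) (auto simp: k)
  moreover have "filter (\<lambda>x. 1 < x) ?xs = ?xs" using gt by (simp add: filter_id_conv)
  ultimately show "row_count 1 (insert_ones k p \<pi>) = p"
    using assms(1) by (simp add: row_count_def)
  show "row_count (Suc i) (insert_ones k p \<pi>) = row_count i \<pi>" if i: "i \<ge> 1"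
  proof -
    let ?f = "filter (\<lambda>x. Suc i < x)" and ?t = "takeWhile (\<lambda>x. x \<noteq> Suc i)"
    have "?f (?t (xs @ replicate k 1 @ ys)) = ?f (?t (xs @ ys))" for xs ys
    proof (cases "Suc i \<in> set xs")
      case True
      then show ?thesis by (simp add: takeWhile_append1)
    next
      case False
      moreover have "?t (replicate k 1 @ ys) = replicate k 1 @ ?t ys"
        using i by (intro takeWhile_append2) auto
      moreover have "?t (xs @ zs) = xs @ ?t zs" for zs using False by (intro takeWhile_append2) auto
      ultimately show ?thesis using i by simp
    qed
    then show ?thesis
      unfolding row_count_def insert_ones_def append_take_drop_id
      by (simp add: takeWhile_map filter_map comp_def)
  qed
qed

lemma stirling_word_map_Suc: "stirling_word (map Suc \<pi>) \<longleftrightarrow> stirling_word \<pi>"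
proof -
  have "(a < b \<and> b < c \<and> c < length (map Suc \<pi>) \<and> map Suc \<pi> ! a = map Suc \<pi> ! c \<and>
        map Suc \<pi> ! b \<noteq> map Suc \<pi> ! a \<longrightarrow> map Suc \<pi> ! b < map Suc \<pi> ! a) \<longleftrightarrow>
      (a < b \<and> b < c \<and> c < length \<pi> \<and> \<pi> ! a = \<pi> ! c \<and> \<pi> ! b \<noteq> \<pi> ! a \<longrightarrow> \<pi> ! b < \<pi> ! a)" for a b c
    by (cases "a < b \<and> b < c \<and> c < length \<pi>") auto
  then show ?thesis unfolding stirling_word_def by (simp only:)
qed

lemma stirling_word_insert_block:
  assumes "1 \<notin> set (xs @ ys)" "\<And>x. x \<in> set (xs @ ys) \<Longrightarrow> 1 \<le> x"
  shows "stirling_word (xs @ replicate k (1::nat) @ ys) \<longleftrightarrow> stirling_word (xs @ ys)"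
proof -
  define L M p where "L = xs @ replicate k 1 @ ys" and "M = xs @ ys" and "p = length xs"
  have nth: "L ! j = (if j < p then M ! j else if j < p + k then 1 else M ! (j - k))" for j
  proof -
    have "j - k - p = j - p - k" by simp
    then show ?thesis unfolding nth_append length_replicate L_def M_def p_def by auto
  qed
  have len: "length L = length M + k" "p \<le> length M" by (auto simp: L_def M_def p_def)
  have M: "M ! j \<noteq> 1 \<and> 1 \<le> M ! j" if "j < length M" for j
    using assms nth_mem[OF that] unfolding M_def by metis
  have "stirling_word M" if S: "stirling_word L"
    unfolding stirling_word_def
  proof (intro allI impI)
    fix a b c assume *: "a < b \<and> b < c \<and> c < length M \<and> M ! a = M ! c \<and> M ! b \<noteq> M ! a"
    define h where "h j = (if j < p then j else j + k)" for j
    have h: "L ! h j = M ! j" for j unfolding nth h_def by auto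
    have "h a < h b" "h b < h c" "h c < length L" using * len by (auto simp: h_def)
    then have "L ! h b < M ! a" by (rule stirling_wordD[OF S]) (use * in \<open>auto simp: h\<close>)
    then show "M ! b < M ! a" by (simp only: h)
  qed
  moreover have "stirling_word L" if S: "stirling_word M"
    unfolding stirling_word_def
  proof (intro allI impI)
    fix a b c assume *: "a < b \<and> b < c \<and> c < length L \<and> L ! a = L ! c \<and> L ! b \<noteq> L ! a"
    define g where "g j = (if j < p then j else j - k)" for j
    have g: "L ! j = M ! g j" "g j < length M" if "\<not> (p \<le> j \<and> j < p + k)" "j < length L" for j
      using that len unfolding nth by (auto simp: g_def)
    have block: "L ! j = 1 \<longleftrightarrow> p \<le> j \<and> j < p + k" if "j < length L" for j
      using g[of j] M[of "g j"] that by (cases "p \<le> j \<and> j < p + k") (auto simp: nth)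
    have lt: "a < length L" "b < length L" "c < length L" using * by auto
    have a1: "\<not> (p \<le> a \<and> a < p + k)"
    proof
      assume "p \<le> a \<and> a < p + k"
      then have "L ! a = 1" "L ! c = 1" using block[OF lt(1)] * by auto
      then have "L ! b = 1" using block[OF lt(1)] block[OF lt(2)] block[OF lt(3)] * by linarith
      then show False using * \<open>L ! a = 1\<close> by simp
    qed
    then have c1: "\<not> (p \<le> c \<and> c < p + k)" using block[OF lt(1)] block[OF lt(3)] * by metis
    show "L ! b < L ! a"
    proof (cases "p \<le> b \<and> b < p + k")
      case True
      then have "L ! b = 1" using block[OF lt(2)] by simp
      moreover have "L ! a \<noteq> 1 \<and> 1 \<le> L ! a" using M[OF g(2)[OF a1 lt(1)]] g(1)[OF a1 lt(1)] by simp
      ultimately show ?thesis by linarith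
    next
      case False
      have "g a < g b" "g b < g c" using * a1 c1 False by (auto simp: g_def)
      then have "M ! g b < L ! a"
        by (rule stirling_wordD[OF S])
          (use g[OF a1 lt(1)] g[OF c1 lt(3)] g[OF False lt(2)] * in auto)
      then show ?thesis using g(1)[OF False lt(2)] by simp
    qed
  qed
  ultimately show ?thesis unfolding L_def M_def by blast
qed

lemma mset_word_Suc:
  "(\<Sum>i\<in>{1..Suc n}. replicate_mset k i) =
     replicate_mset k (1::nat) + image_mset Suc (\<Sum>i\<in>{1..n}. replicate_mset k i)"
proof -
  have "image_mset Suc (\<Sum>i\<in>{1..n}. replicate_mset k i) = (\<Sum>i\<in>{1..n}. replicate_mset k (Suc i))"
    by (induction n) auto
  moreover have "(\<Sum>i\<in>{1..Suc n}. replicate_mset k i) = replicate_mset k 1 + (\<Sum>i\<in>{Suc 1..Suc n}. replicate_mset k i)"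
    by (rule sum.atLeast_Suc_atMost) simp
  ultimately show ?thesis by (simp add: sum.shift_bounds_cl_Suc_ivl del: sum.cl_ivl_Suc)
qed

lemma insert_ones_kstirling:
  assumes "k \<ge> 1" "\<pi> \<in> kstirling k n"
  shows "insert_ones k p \<pi> \<in> kstirling k (Suc n)"
proof -
  have 0: "0 \<notin> set \<pi>" using set_kstirling[OF assms(2,1)] by simp
  have "mset (insert_ones k p \<pi>) = replicate_mset k 1 + mset (take p (map Suc \<pi>) @ drop p (map Suc \<pi>))"
    unfolding insert_ones_def mset_append mset_replicate by (rule add.left_commute)
  also have "\<dots> = replicate_mset k 1 + image_mset Suc (mset \<pi>)" by (simp only: append_take_drop_id mset_map)
  finally have "mset (insert_ones k p \<pi>) = (\<Sum>i\<in>{1..Suc n}. replicate_mset k i)"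
    using assms(2) unfolding mset_word_Suc by (simp only: kstirling_iff)
  moreover have "stirling_word (insert_ones k p \<pi>)"
    unfolding insert_ones_def
  proof (subst stirling_word_insert_block, unfold append_take_drop_id)
    show "1 \<notin> set (map Suc \<pi>)" using 0 by auto
    show "stirling_word (map Suc \<pi>)" using assms(2) by (simp add: stirling_word_map_Suc kstirling_iff)
  qed auto
  ultimately show ?thesis by (simp only: kstirling_iff)
qed

text \<open>Only smaller letters may stand between two equal ones, so the copies of 1 are contiguous.\<close>

lemma kstirling_SucE:
  assumes k: "k \<ge> 1" and \<pi>: "\<pi> \<in> kstirling k (Suc n)"
  obtains p \<rho> where "p \<le> k * n" "\<rho> \<in> kstirling k n" "\<pi> = insert_ones k p \<rho>"
proof -
  have S: "stirling_word \<pi>" using \<pi> by (simp add: kstirling_iff)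
  have pos: "1 \<le> x" if "x \<in> set \<pi>" for x using that set_kstirling[OF \<pi> k] by simp
  define xs B where "xs = takeWhile (\<lambda>x. x \<noteq> 1) \<pi>" and "B = dropWhile (\<lambda>x. x \<noteq> 1) \<pi>"
  define zs ys where "zs = takeWhile (\<lambda>x. x = 1) B" and "ys = dropWhile (\<lambda>x. x = 1) B"
  have eq: "\<pi> = xs @ zs @ ys" by (simp add: xs_def B_def zs_def ys_def)
  have xs: "1 \<notin> set xs" unfolding xs_def by (auto dest: set_takeWhileD)
  have ys: "1 \<notin> set ys"
  proof
    assume 1: "1 \<in> set ys"
    then obtain y ys' where y: "ys = y # ys'" by (cases ys) auto
    then have y1: "y \<noteq> 1" unfolding ys_def by (auto simp: dropWhile_eq_Cons_conv)
    have "1 \<in> set ys'" using 1 y y1 by simp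
    then obtain m where m: "m < length ys'" "ys' ! m = 1" by (auto simp: in_set_conv_nth)
    have "B \<noteq> []" using y by (auto simp: ys_def)
    then have "hd B = 1" using hd_dropWhile[of "\<lambda>x. x \<noteq> 1" \<pi>] unfolding B_def by blast
    then obtain zs' where z: "zs = 1 # zs'" using \<open>B \<noteq> []\<close> by (cases B) (auto simp: zs_def)
    have "\<pi> ! (length xs + length zs) < 1"
      by (rule stirling_wordD[OF S, of "length xs" _ "length xs + length zs + 1 + m"])
        (use m y1 in \<open>simp_all add: eq y z nth_append\<close>)
    moreover have "\<pi> ! (length xs + length zs) = y" by (simp add: eq y nth_append)
    ultimately show False using pos[of y] by (simp add: eq y)
  qed
  have rep: "zs = replicate (length zs) 1"
    by (rule replicate_eqI) (auto simp: zs_def dest: set_takeWhileD)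
  have "count (mset xs) 1 = 0" "count (mset ys) 1 = 0" using xs ys by (simp_all add: count_mset_0_iff)
  moreover have "count (mset zs) 1 = length zs" by (subst rep) simp
  moreover have "count (mset \<pi>) 1 = k" using count_kstirling[OF \<pi>, of 1] by simp
  moreover have "count (mset \<pi>) 1 = count (mset xs) 1 + (count (mset zs) 1 + count (mset ys) 1)"
    by (simp add: eq)
  ultimately have "length zs = k" by linarith
  then have zs: "zs = replicate k 1" using rep by simp
  define \<rho> where "\<rho> = map (\<lambda>x. x - 1) (xs @ ys)"
  have S\<rho>: "map Suc \<rho> = xs @ ys"
    unfolding \<rho>_def map_map
  proof (rule map_idI)
    fix x assume "x \<in> set (xs @ ys)"
    then have "1 \<le> x" using pos[of x] by (auto simp: eq)
    then show "(Suc \<circ> (\<lambda>x. x - 1)) x = x" by simp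
  qed
  have ins: "\<pi> = insert_ones k (length xs) \<rho>"
    unfolding insert_ones_def S\<rho> using eq zs by simp
  have "replicate_mset k 1 + image_mset Suc (mset \<rho>) = mset \<pi>"
    unfolding mset_map[symmetric] S\<rho> eq zs by (simp add: ac_simps)
  also have "\<dots> = replicate_mset k 1 + image_mset Suc (\<Sum>i\<in>{1..n}. replicate_mset k i)"
    using \<pi> unfolding kstirling_iff mset_word_Suc[symmetric] by simp
  finally have "image_mset Suc (mset \<rho>) = image_mset Suc (\<Sum>i\<in>{1..n}. replicate_mset k i)" by simp
  then have "image_mset (\<lambda>x. x - 1) (image_mset Suc (mset \<rho>)) =
      image_mset (\<lambda>x. x - 1) (image_mset Suc (\<Sum>i\<in>{1..n}. replicate_mset k i))" by (rule arg_cong)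
  then have "mset \<rho> = (\<Sum>i\<in>{1..n}. replicate_mset k i)"
    by (simp only: multiset.map_comp comp_def diff_Suc_1 multiset.map_ident)
  moreover have "stirling_word \<rho>"
    using S stirling_word_insert_block[of xs ys k] xs ys pos unfolding eq zs
    by (subst stirling_word_map_Suc[symmetric], subst S\<rho>) auto
  ultimately have \<rho>: "\<rho> \<in> kstirling k n" by (simp only: kstirling_iff)
  have "length xs \<le> length \<rho>" by (simp add: \<rho>_def)
  then show thesis using that[OF _ \<rho> ins] length_kstirling[OF \<rho>] by simp
qed

lemma row_count_insert_ones_kstirling:
  assumes "k \<ge> 1" "\<pi> \<in> kstirling k n" "p \<le> k * n"
  shows "row_count 1 (insert_ones k p \<pi>) = p"
    and "i \<ge> 1 \<Longrightarrow> row_count (Suc i) (insert_ones k p \<pi>) = row_count i \<pi>"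
proof -
  have "p \<le> length \<pi>" "0 \<notin> set \<pi>"
    using assms(3) set_kstirling[OF assms(2,1)] length_kstirling[OF assms(2)] by auto
  note rc = row_count_insert_ones[OF this assms(1)]
  show "row_count 1 (insert_ones k p \<pi>) = p" by (rule rc(1))
  show "i \<ge> 1 \<Longrightarrow> row_count (Suc i) (insert_ones k p \<pi>) = row_count i \<pi>" by (rule rc(2))
qed

lemma row_count_le:
  assumes "k \<ge> 1" "\<pi> \<in> kstirling k n" "1 \<le> i" "i \<le> n"
  shows "row_count i \<pi> \<le> k * (n - i)"
  using assms(2-)
proof (induction n arbitrary: \<pi> i)
  case (Suc n)
  obtain p \<rho> where \<rho>: "p \<le> k * n" "\<rho> \<in> kstirling k n" "\<pi> = insert_ones k p \<rho>"
    using kstirling_SucE[OF assms(1) Suc.prems(1)] .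
  note rc = row_count_insert_ones_kstirling[OF assms(1) \<rho>(2,1), folded \<rho>(3)]
  show ?case
  proof (cases "i = 1")
    case False
    then obtain i' where i': "i = Suc i'" "1 \<le> i'" "i' \<le> n" using Suc.prems by (cases i) auto
    then show ?thesis using rc(2)[OF i'(2)] Suc.IH[OF \<rho>(2) i'(2,3)] by simp
  qed (use rc(1) \<rho>(1) in simp)
qed simp

lemma row_count_inject:
  assumes "k \<ge> 1" "\<pi> \<in> kstirling k n" "\<pi>' \<in> kstirling k n"
    and "\<And>i. 1 \<le> i \<Longrightarrow> i \<le> n \<Longrightarrow> row_count i \<pi> = row_count i \<pi>'"
  shows "\<pi> = \<pi>'"
  using assms(2-)
proof (induction n arbitrary: \<pi> \<pi>')
  case 0
  then show ?case by (simp add: kstirling_iff)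
next
  case (Suc n)
  obtain p \<rho> where \<rho>: "p \<le> k * n" "\<rho> \<in> kstirling k n" "\<pi> = insert_ones k p \<rho>"
    using kstirling_SucE[OF assms(1) Suc.prems(1)] .
  obtain p' \<rho>' where \<rho>': "p' \<le> k * n" "\<rho>' \<in> kstirling k n" "\<pi>' = insert_ones k p' \<rho>'"
    using kstirling_SucE[OF assms(1) Suc.prems(2)] .
  note rc = row_count_insert_ones_kstirling[OF assms(1) \<rho>(2,1), folded \<rho>(3)]
  note rc' = row_count_insert_ones_kstirling[OF assms(1) \<rho>'(2,1), folded \<rho>'(3)]
  have "p = p'" using Suc.prems(3)[of 1] rc(1) rc'(1) by simp
  moreover have "\<rho> = \<rho>'"
  proof (rule Suc.IH[OF \<rho>(2) \<rho>'(2)])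
    fix i assume "1 \<le> i" "i \<le> n"
    then show "row_count i \<rho> = row_count i \<rho>'"
      using rc(2)[of i] rc'(2)[of i] Suc.prems(3)[of "Suc i"] by simp
  qed
  ultimately show ?case using \<rho>(3) \<rho>'(3) by simp
qed

text \<open>The position of the block of ones ranges over \<open>c 1, \<dots>, k * (n - 1)\<close>, independently of the remaining word,
  whose code is the rest of the code.\<close>

theorem kstirling_generating_function:
  assumes k: "k \<ge> 1" and "\<And>i. 1 \<le> i \<Longrightarrow> i \<le> n \<Longrightarrow> c i \<le> k * (n - i)"
  shows "(\<Sum>\<pi>\<in>{\<pi> \<in> kstirling k n. \<forall>i\<in>{1..n}. c i \<le> row_count i \<pi>}.
            monom (1 :: int) (\<Sum>i=1..n. row_count i \<pi> - c i)) =
         (\<Prod>i=1..n. \<Sum>t\<le>k * (n - i) - c i. monom 1 t)"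
  using assms(2)
proof (induction n arbitrary: c)
  case 0
  have "{\<pi> \<in> kstirling k 0. \<forall>i\<in>{1..0}. c i \<le> row_count i \<pi>} = {[]}"
    by (auto simp: kstirling_iff stirling_word_def)
  then show ?case by simp
next
  case (Suc n)
  let ?c = "c \<circ> Suc"
  define A where "A = {\<pi> \<in> kstirling k n. \<forall>i\<in>{1..n}. ?c i \<le> row_count i \<pi>}"
  define B where "B = {\<pi> \<in> kstirling k (Suc n). \<forall>i\<in>{1..Suc n}. c i \<le> row_count i \<pi>}"
  define r where "r = k * n - c 1"
  have c1: "c 1 \<le> k * n" using Suc.prems[of 1] by simp
  define f where "f = (\<lambda>(\<pi>, t). insert_ones k (c 1 + t) \<pi>)"
  have all: "(\<forall>i\<in>{1..Suc n}. P i) \<longleftrightarrow> P 1 \<and> (\<forall>i\<in>{1..n}. P (Suc i))" for P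
  proof -
    have "{1..Suc n} = insert 1 (Suc ` {1..n})" by (auto simp: image_Suc_atLeastAtMost)
    then show ?thesis by (simp only: ball_simps)
  qed
  have p: "c 1 + t \<le> k * n" if "t \<le> r" for t using that c1 by (simp add: r_def)
  note rc = row_count_insert_ones_kstirling[OF k _ p]
  have bij: "bij_betw f (A \<times> {..r}) B"
    unfolding bij_betw_def
  proof
    show "inj_on f (A \<times> {..r})"
    proof (rule inj_onI)
      fix x x' assume "x \<in> A \<times> {..r}" "x' \<in> A \<times> {..r}" "f x = f x'"
      then obtain \<pi> t \<pi>' t' where x: "x = (\<pi>, t)" "x' = (\<pi>', t')"
        and t: "t \<le> r" "t' \<le> r" and \<pi>: "\<pi> \<in> kstirling k n" "\<pi>' \<in> kstirling k n"
        and e: "insert_ones k (c 1 + t) \<pi> = insert_ones k (c 1 + t') \<pi>'"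
        by (cases x, cases x') (auto simp: f_def A_def)
      have "t = t'" using rc(1)[OF \<pi>(1) t(1)] rc(1)[OF \<pi>(2) t(2)] e by simp
      moreover have "\<pi> = \<pi>'"
        by (rule row_count_inject[OF k \<pi>]) (metis rc(2) \<pi> t e)
      ultimately show "x = x'" using x by simp
    qed
    show "f ` (A \<times> {..r}) = B"
    proof
      show "f ` (A \<times> {..r}) \<subseteq> B"
      proof
        fix \<rho> assume "\<rho> \<in> f ` (A \<times> {..r})"
        then obtain \<pi> t where \<pi>: "\<pi> \<in> A" "t \<le> r" "\<rho> = insert_ones k (c 1 + t) \<pi>" by (auto simp: f_def)
        then have "\<pi> \<in> kstirling k n" by (simp add: A_def)
        then show "\<rho> \<in> B"
          using insert_ones_kstirling[OF k] rc \<pi> unfolding B_def all by (auto simp: A_def)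
      qed
      show "B \<subseteq> f ` (A \<times> {..r})"
      proof
        fix \<rho> assume \<rho>: "\<rho> \<in> B"
        then have "\<rho> \<in> kstirling k (Suc n)" by (simp add: B_def)
        then obtain p \<pi> where \<pi>: "p \<le> k * n" "\<pi> \<in> kstirling k n" "\<rho> = insert_ones k p \<pi>"
          using kstirling_SucE[OF k] by blast
        note rc' = row_count_insert_ones_kstirling[OF k \<pi>(2,1), folded \<pi>(3)]
        have "c 1 \<le> p" "\<pi> \<in> A" using \<rho> rc' \<pi>(2) unfolding A_def B_def all by auto
        then show "\<rho> \<in> f ` (A \<times> {..r})"
          using \<pi> by (intro image_eqI[of _ _ "(\<pi>, p - c 1)"]) (auto simp: f_def r_def)
      qed
    qed
  qed
  have "(\<Sum>\<pi>\<in>B. monom (1 :: int) (\<Sum>i=1..Suc n. row_count i \<pi> - c i)) =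
      (\<Sum>x\<in>A \<times> {..r}. monom 1 (\<Sum>i=1..Suc n. row_count i (f x) - c i))"
    by (rule sum.reindex_bij_betw[OF bij, symmetric])
  also have "\<dots> = (\<Sum>(\<pi>, t)\<in>A \<times> {..r}. monom 1 (\<Sum>i=1..n. row_count i \<pi> - ?c i) * monom 1 t)"
  proof (rule sum.cong[OF refl])
    fix x assume "x \<in> A \<times> {..r}"
    then obtain \<pi> t where x: "x = (\<pi>, t)" "\<pi> \<in> kstirling k n" "t \<le> r" by (auto simp: A_def)
    have "(\<Sum>i=1..Suc n. row_count i (f x) - c i) =
        (row_count 1 (f x) - c 1) + (\<Sum>i=1..n. row_count (Suc i) (f x) - c (Suc i))"
      by (simp add: sum.atLeast_Suc_atMost sum.shift_bounds_cl_Suc_ivl del: sum.cl_ivl_Suc)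
    also have "\<dots> = t + (\<Sum>i=1..n. row_count i \<pi> - ?c i)"
      using rc[OF x(2,3)] by (simp add: f_def x(1))
    finally have "(\<Sum>i=1..Suc n. row_count i (f x) - c i) = t + (\<Sum>i=1..n. row_count i \<pi> - ?c i)" .
    then show "monom (1 :: int) (\<Sum>i=1..Suc n. row_count i (f x) - c i) =
        (case x of (\<pi>, t) \<Rightarrow> monom 1 (\<Sum>i=1..n. row_count i \<pi> - ?c i) * monom 1 t)"
      by (simp add: x(1) mult_monom add.commute del: sum.cl_ivl_Suc)
  qed
  also have "\<dots> = (\<Sum>\<pi>\<in>A. monom 1 (\<Sum>i=1..n. row_count i \<pi> - ?c i)) * (\<Sum>t\<le>r. monom 1 t)"
    by (simp add: sum_product sum.cartesian_product)
  also have "(\<Sum>\<pi>\<in>A. monom (1 :: int) (\<Sum>i=1..n. row_count i \<pi> - ?c i)) =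
      (\<Prod>i=1..n. \<Sum>t\<le>k * (n - i) - ?c i. monom 1 t)"
    unfolding A_def by (rule Suc.IH) (use Suc.prems in force)
  also have "\<dots> * (\<Sum>t\<le>r. monom 1 t) = (\<Prod>i=1..Suc n. \<Sum>t\<le>k * (Suc n - i) - c i. monom 1 t)"
    unfolding r_def
    by (simp add: prod.atLeast_Suc_atMost prod.shift_bounds_cl_Suc_ivl mult.commute del: prod.cl_ivl_Suc)
  finally show ?case unfolding B_def .
qed


section \<open>The Bruhat up-set of a 132-avoiding permutation\<close>

lemma le_row_count_if_prefix:
  assumes "\<And>j. j < d \<Longrightarrow> i < \<pi> ! j" "d \<le> length \<pi>"
  shows "d \<le> row_count i \<pi>"
proof -
  have gt: "i < x" if "x \<in> set (take d \<pi>)" for x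
    using that assms by (auto simp: in_set_conv_nth)
  have "takeWhile (\<lambda>x. x \<noteq> i) (take d \<pi> @ drop d \<pi>) = take d \<pi> @ takeWhile (\<lambda>x. x \<noteq> i) (drop d \<pi>)"
    using gt by (intro takeWhile_append2) auto
  moreover have "filter ((<) i) (take d \<pi>) = take d \<pi>" using gt by (simp add: filter_id_conv)
  ultimately show ?thesis using assms(2) by (simp add: row_count_def)
qed

text \<open>A smaller letter among the first \<open>row_count i \<sigma>\<close> positions pushes some letter exceeding \<open>i\<close> behind
  it but in front of the first \<open>i\<close>, and these three letters form the pattern 132.\<close>

lemma avoids_132_prefix:
  assumes av: "avoids_132 \<sigma>" and i: "i \<in> set \<sigma>" and j: "j < row_count i \<sigma>"
  shows "i < \<sigma> ! j"
proof (rule ccontr)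
  assume neg: "\<not> ?thesis"
  define tw where "tw = takeWhile (\<lambda>x. x \<noteq> i) \<sigma>"
  define G where "G = {m. m < length tw \<and> i < tw ! m}"
  have nth: "tw ! m = \<sigma> ! m" if "m < length tw" for m
    using that by (simp add: tw_def takeWhile_nth)
  have rc: "row_count i \<sigma> = card G"
    by (simp add: row_count_def tw_def G_def length_filter_conv_card)
  have "card G \<le> length tw"
    using card_mono[of "{..<length tw}" G] by (auto simp: G_def)
  then have jt: "j < length tw" using j rc by simp
  have "tw \<noteq> \<sigma>" using i by (auto simp: tw_def takeWhile_eq_all_conv)
  then have len: "length tw < length \<sigma>"
    unfolding tw_def by (metis le_neq_implies_less length_takeWhile_le takeWhile_eq_take take_all_iff order_refl)
  then have l: "\<sigma> ! length tw = i"
    using nth_length_takeWhile[of "\<lambda>x. x \<noteq> i" \<sigma>] by (simp add: tw_def)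
  have "tw ! j \<in> set tw" using jt by simp
  then have "\<sigma> ! j \<noteq> i" using nth[OF jt] by (auto simp: tw_def dest: set_takeWhileD)
  then have ji: "\<sigma> ! j < i" using neg by simp
  have "\<not> G \<subseteq> {..<j}"
  proof
    assume "G \<subseteq> {..<j}"
    then have "card G \<le> j" using card_mono[of "{..<j}" G] by simp
    then show False using j rc by simp
  qed
  then obtain m where "m \<in> G" "\<not> m < j" by auto
  then have m: "j \<le> m" "m < length tw" "i < tw ! m" by (auto simp: G_def)
  then have "m \<noteq> j" using neg nth[OF jt] by auto
  then have "j < m \<and> m < length tw \<and> length tw < length \<sigma> \<and> \<sigma> ! j < \<sigma> ! length tw \<and> \<sigma> ! length tw < \<sigma> ! m"
    using m len l ji nth[OF m(2)] by simp
  then show False using av unfolding avoids_132_def by blast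
qed

text \<open>A cover exchanges a smaller letter with a larger one to its right. If the right position is among
  the first \<open>d\<close>, then so is the left one, and hence already the smaller letter exceeds \<open>i\<close>.\<close>

lemma kbruhat_cover_prefix:
  assumes cov: "kbruhat_cover k n \<sigma> \<pi>" and pre: "\<And>j. j < d \<Longrightarrow> i < \<sigma> ! j" and j: "j < d" "d \<le> length \<sigma>"
  shows "i < \<pi> ! j"
proof -
  obtain as where as: "length as = k + 1" "sorted_wrt (<) as" "as ! k < length \<sigma>"
      "\<sigma> ! (as ! 0) < \<sigma> ! (as ! k)"
    and pi: "\<pi> = \<sigma>[as ! 0 := \<sigma> ! (as ! k), as ! k := \<sigma> ! (as ! 0)]"
    using cov unfolding kbruhat_cover_def by auto
  have "k \<noteq> 0" using as(4) by (metis less_irrefl)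
  then have a: "as ! 0 < as ! k" using sorted_wrt_nth_less[OF as(2), of 0 k] as(1) by simp
  then show ?thesis
    using pre[of "as ! 0"] pre[OF j(1)] j as(3,4) unfolding pi by (auto simp: nth_list_update)
qed

lemma kbruhat_le_prefix:
  assumes "kbruhat_le k n \<sigma> \<pi>" "\<And>j. j < d \<Longrightarrow> i < \<sigma> ! j" "d \<le> length \<sigma>"
  shows "length \<pi> = length \<sigma> \<and> (\<forall>j<d. i < \<pi> ! j)"
  using assms(1) unfolding kbruhat_le_def
proof (induction rule: rtranclp_induct)
  case (step \<tau> \<pi>)
  have "length \<pi> = length \<tau>" using step.hyps(2) unfolding kbruhat_cover_def by auto
  then show ?case using step.IH kbruhat_cover_prefix[OF step.hyps(2), of d i] assms(3) by simp
qed (use assms in simp)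

lemma row_count_prefix:
  assumes i: "i \<notin> set X"
  shows "row_count i (X @ Y) = length (filter ((<) i) X) + row_count i Y"
proof -
  have "takeWhile (\<lambda>x. x \<noteq> i) (X @ Y) = X @ takeWhile (\<lambda>x. x \<noteq> i) Y"
    using i by (intro takeWhile_append2) auto
  then show ?thesis by (simp add: row_count_def)
qed

lemma row_count_stop: "i \<in> set X \<Longrightarrow> row_count i (X @ Y) = row_count i X"
  by (simp add: row_count_def takeWhile_append1)

lemma row_count_Cons:
  "row_count i (x # Y) = (if x = i then 0 else (if i < x then 1 else 0) + row_count i Y)"
  by (cases "x = i") (simp_all add: row_count_def)

text \<open>The letters of \<open>M\<close> are too small to be counted for \<open>i\<close> or any larger letter, and a letter smaller
  than \<open>i\<close> does not distinguish between \<open>i\<close> and \<open>v\<close>. So only the entry for \<open>i\<close> notices the exchange.\<close>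

lemma row_count_exchange:
  assumes iv: "i < v" and M: "\<And>x. x \<in> set M \<Longrightarrow> x \<le> i" and X: "i \<notin> set X"
  shows "row_count i (X @ v # M @ i # Z) = Suc (row_count i (X @ i # M @ v # Z))"
    and "j \<noteq> i \<Longrightarrow> row_count j (X @ v # M @ i # Z) = row_count j (X @ i # M @ v # Z)"
proof -
  have z: "row_count i (M @ i # Z) = 0"
  proof (cases "i \<in> set M")
    case True
    have "\<not> i < x" if "x \<in> set (takeWhile (\<lambda>x. x \<noteq> i) M)" for x
      using M[of x] that by (auto dest: set_takeWhileD)
    then show ?thesis using True by (simp add: row_count_stop) (auto simp: row_count_def filter_empty_conv)
  next
    case False
    have "\<not> i < x" if "x \<in> set M" for x using M[OF that] by simp
    then show ?thesis using False by (auto simp: row_count_prefix row_count_Cons filter_empty_conv)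
  qed
  then show "row_count i (X @ v # M @ i # Z) = Suc (row_count i (X @ i # M @ v # Z))"
    using X iv by (simp add: row_count_prefix row_count_Cons)
  show "row_count j (X @ v # M @ i # Z) = row_count j (X @ i # M @ v # Z)" if ji: "j \<noteq> i"
  proof (cases "j \<in> set X")
    case True
    then show ?thesis by (simp add: row_count_stop)
  next
    case False
    have "row_count j (v # M @ i # Z) = row_count j (i # M @ v # Z)"
    proof (cases "j < i")
      case True
      then show ?thesis using iv
        by (cases "j \<in> set M") (auto simp: row_count_Cons row_count_prefix row_count_stop)
    next
      case False
      then have "j \<notin> set M" "\<not> j < i" "filter ((<) j) M = []" using ji M by (force simp: filter_empty_conv)+
      then show ?thesis using ji by (auto simp: row_count_Cons row_count_prefix)
    qed
    then show ?thesis using False by (simp add: row_count_prefix)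
  qed
qed

lemma nth_between:
  assumes "length X < m" "m < length X + 1 + length M"
  shows "(X @ v # M @ i # Z) ! m \<in> set M"
proof -
  obtain d where "m = Suc (length X + d)" using less_imp_Suc_add[OF assms(1)] by blast
  then show ?thesis using assms(2) by (simp add: nth_append)
qed

lemma nth_after:
  assumes "length X + 1 + length M < m" "m < length (X @ v # M @ i # Z)"
  shows "(X @ v # M @ i # Z) ! m \<in> set Z"
proof -
  obtain d where "m = Suc (length X + 1 + length M + d)" using less_imp_Suc_add[OF assms(1)] by blast
  then show ?thesis using assms(2) by (simp add: nth_append)
qed

text \<open>Between the exchanged positions all letters are at most \<open>i\<close>. A forbidden pattern of the new word that
  uses an exchanged position would still be forbidden in the old word with the other exchanged position
  in its place.\<close>

lemma stirling_word_exchange: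
  assumes S: "stirling_word (X @ v # M @ i # Z)" and iv: "i < v"
    and M: "\<And>x. x \<in> set M \<Longrightarrow> x \<le> i" and X: "i \<notin> set X" and Z: "i \<notin> set Z"
  shows "stirling_word (X @ i # M @ v # Z)"
  unfolding stirling_word_def
proof (intro allI impI)
  define P Q where "P = X @ v # M @ i # Z" and "Q = X @ i # M @ v # Z"
  define p r where "p = length X" and "r = length X + 1 + length M"
  fix a b c assume "a < b \<and> b < c \<and> c < length (X @ i # M @ v # Z) \<and>
    (X @ i # M @ v # Z) ! a = (X @ i # M @ v # Z) ! c \<and> (X @ i # M @ v # Z) ! b \<noteq> (X @ i # M @ v # Z) ! a"
  then have abc: "a < b" "b < c" "c < length Q" "Q ! a = Q ! c" "Q ! b \<noteq> Q ! a"
    unfolding Q_def by blast+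
  have S: "stirling_word P" using S by (simp add: P_def)
  have len: "length Q = length P" by (simp add: P_def Q_def)
  have pr: "p < r" "r < length P" by (auto simp: p_def r_def P_def)
  have at: "P ! p = v" "P ! r = i" "Q ! p = i" "Q ! r = v"
    by (auto simp: P_def Q_def p_def r_def nth_append)
  have same: "Q ! m = P ! m" if "m \<noteq> p" "m \<noteq> r" for m
    using that by (auto simp: P_def Q_def p_def r_def nth_append nth_Cons split: nat.splits)
  have left: "P ! m \<noteq> i" if "m < p" for m
    using X that nth_mem[of m X] by (auto simp: P_def p_def nth_append)
  have mid: "P ! m \<le> i" if "p < m" "m < r" for m
    using M nth_between[of X m M v i Z] that by (simp add: P_def p_def r_def)
  have right: "P ! m \<noteq> i" if "r < m" "m < length P" for m
    using Z nth_after[of X M m v i Z] that unfolding P_def r_def by metis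
  note st = stirling_wordD[OF S]
  have "Q ! b < Q ! a"
  proof -
    consider "Q ! a = i" | "Q ! a = v" | "Q ! a \<noteq> i" "Q ! a \<noteq> v" by blast
    then show ?thesis
    proof cases
      case 1
      have "p \<le> a" "c < r"
        using 1 abc left[of a] right[of c] same at iv pr len by (metis linorder_not_le linorder_cases nat_neq_iff less_irrefl)+
      then have "Q ! b \<le> i" using mid[of b] same[of b] abc by simp
      then show ?thesis using 1 abc by simp
    next
      case 2
      show ?thesis
      proof (cases "b \<in> {p<..<r} \<or> b = p")
        case True
        then have "Q ! b \<le> i" using mid[of b] same[of b] at by auto
        then show ?thesis using 2 iv by simp
      next
        case False
        have br: "b \<noteq> r" using 2 abc at by auto
        have ap: "a \<noteq> p" using 2 at iv by auto
        have cp: "c \<noteq> p" using 2 at iv abc by auto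
        have Qb: "Q ! b = P ! b" using same False br by auto
        \<comment> \<open>the moved copy of \<open>v\<close> is traced back to its old position \<open>p\<close>\<close>
        define a' c' where "a' = (if a = r then p else a)" and "c' = (if c = r then p else c)"
        have "P ! a' = v" "P ! c' = v" using same[of a] same[of c] ap cp at 2 abc by (auto simp: a'_def c'_def)
        moreover have "a' < b" using abc pr by (auto simp: a'_def)
        moreover have "b < c'" "c' < length P" using False br abc pr len by (auto simp: c'_def)
        ultimately have "P ! b < v" using 2 abc Qb by (intro st[of a' b c']) auto
        then show ?thesis using 2 Qb by simp
      qed
    next
      case 3
      then have ac: "a \<noteq> p" "a \<noteq> r" "c \<noteq> p" "c \<noteq> r" using at abc by auto
      then have P: "P ! a = Q ! a" "P ! c = Q ! a" using same[of a] same[of c] abc by auto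
      have cl: "c < length P" using abc len by simp
      consider "b = p" | "b = r" | "b \<noteq> p" "b \<noteq> r" by blast
      then show ?thesis
      proof cases
        case 1
        then have "v < Q ! a" using st[of a p c "Q ! a"] abc cl P at 3 by simp
        then show ?thesis using 1 at iv by simp
      next
        case 2
        then have i: "i < Q ! a" using st[of a r c "Q ! a"] abc cl P at 3 by simp
        have "a < p" using mid[of a] i P ac abc 2 by (metis linorder_neqE_nat linorder_not_le)
        then have "v < Q ! a" using st[of a p c "Q ! a"] abc cl P at 3 2 pr by simp
        then show ?thesis using 2 at by simp
      next
        case b: 3
        then show ?thesis using st[of a b c "Q ! a"] abc cl P same[of b] by simp
      qed
    qed
  qed
  then show "(X @ i # M @ v # Z) ! b < (X @ i # M @ v # Z) ! a" by (simp only: Q_def)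
qed

text \<open>The positions \<open>a\<^sub>1 < \<dots> < a\<^sub>k\<^sub>+\<^sub>1\<close> of the cover are the position of \<open>v\<close> followed by the \<open>k\<close> positions
  of \<open>i\<close> in \<open>\<pi>\<close>.\<close>

lemma kbruhat_cover_exchange:
  assumes k: "k \<ge> 1" and \<pi>: "\<pi> \<in> kstirling k n" "\<pi> = X @ v # M @ i # Z" and iv: "i < v"
    and M: "\<And>x. x \<in> set M \<Longrightarrow> x \<le> i" and X: "i \<notin> set X" and Z: "i \<notin> set Z"
  shows "kbruhat_cover k n (X @ i # M @ v # Z) \<pi>"
proof -
  define \<sigma> where "\<sigma> = X @ i # M @ v # Z"
  define p r where "p = length X" and "r = length X + 1 + length M"
  have \<sigma>: "\<sigma> \<in> kstirling k n"
    using \<pi> stirling_word_exchange[of X v M i Z] iv M X Z unfolding kstirling_iff \<sigma>_def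
    by (simp add: add_mset_commute)
  define ps where "ps = sorted_list_of_set {m. m < length \<pi> \<and> \<pi> ! m = i}"
  have set_ps: "set ps = {m. m < length \<pi> \<and> \<pi> ! m = i}" by (simp add: ps_def)
  have sorted: "sorted_wrt (<) ps" by (simp add: ps_def)
  have "i \<in> {1..n}" using set_kstirling[OF \<pi>(1) k] \<pi>(2) by auto
  then have len: "length ps = k"
    using count_kstirling[OF \<pi>(1), of i] by (simp add: ps_def count_mset_card)
  have at: "\<pi> ! p = v" "\<pi> ! r = i" "\<sigma> ! p = i" "\<sigma> ! r = v" "r < length \<pi>" "p < r" "length \<sigma> = length \<pi>"
    by (auto simp: \<pi>(2) \<sigma>_def p_def r_def nth_append)
  have same: "\<sigma> ! m = \<pi> ! m" if "m \<noteq> p" "m \<noteq> r" for m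
    using that by (auto simp: \<pi>(2) \<sigma>_def p_def r_def nth_append nth_Cons split: nat.splits)
  have mid: "\<pi> ! m \<le> i" if "p < m" "m < r" for m
    using M nth_between[of X m M v i Z] that by (simp add: \<pi>(2) p_def r_def)
  have ps_bounds: "p < m \<and> m \<le> r" if "m \<in> set ps" for m
  proof -
    have m: "m < length \<pi>" "\<pi> ! m = i" using that by (auto simp: set_ps)
    have "m \<noteq> p" using m at iv by auto
    moreover have "\<not> m < p" using m X nth_mem[of m X] by (auto simp: \<pi>(2) p_def nth_append)
    moreover have "\<not> r < m"
      using m Z nth_after[of X M m v i Z] unfolding \<pi>(2) r_def by metis
    ultimately show ?thesis by simp
  qed
  have last: "ps ! (k - 1) = r"
  proof -
    have "r \<in> set ps" using at by (simp add: set_ps)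
    then obtain m where m: "m < k" "ps ! m = r" using len by (auto simp: in_set_conv_nth)
    have "\<not> m < k - 1"
      using sorted_wrt_nth_less[OF sorted, of m "k - 1"] m len ps_bounds[of "ps ! (k - 1)"] k by auto
    then show ?thesis using m by (metis Suc_diff_1 Suc_lessI Suc_pred' k less_Suc_eq not_less_zero One_nat_def Suc_le_lessD)
  qed
  define as where "as = p # ps"
  have as0: "as ! 0 = p" and ask: "as ! k = r" using last k by (simp_all add: as_def nth_Cons')
  have sorted_as: "sorted_wrt (<) as" using sorted ps_bounds by (auto simp: as_def)
  have len_as: "length as = k + 1" by (simp add: as_def len)
  have eq: "\<sigma> ! (as ! j) = \<sigma> ! (as ! 0)" if "j < k" for j
  proof (cases j)
    case (Suc j')
    have "ps ! j' \<in> set ps" using Suc that len by simp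
    moreover have "ps ! j' < ps ! (k - 1)"
      by (rule sorted_wrt_nth_less[OF sorted]) (use Suc that len in auto)
    ultimately have "\<sigma> ! (ps ! j') = i"
      using same[of "ps ! j'"] ps_bounds[of "ps ! j'"] last by (auto simp: set_ps)
    then show ?thesis using Suc at as0 by (simp add: as_def)
  qed simp
  have gap: "\<sigma> ! m < \<sigma> ! (as ! 0)" if m: "as ! (k - 1) < m" "m < as ! k" for m
  proof -
    have "p \<le> as ! (k - 1)"
      using sorted_wrt_nth_less[OF sorted_as, of 0 "k - 1"] len_as as0
      by (cases "k - 1 = 0") (simp_all add: less_Suc_eq_le)
    then have pm: "p < m" "m < r" using m ask by auto
    have "\<pi> ! m \<noteq> i"
    proof
      assume "\<pi> ! m = i"
      then have "m \<in> set as" using pm at by (simp add: as_def set_ps)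
      then obtain l where l: "l < k + 1" "as ! l = m" using len_as by (auto simp: in_set_conv_nth)
      have "\<not> l < k - 1" "l \<noteq> k - 1"
        using sorted_wrt_nth_less[OF sorted_as, of l "k - 1"] len_as l m by (auto simp: less_Suc_eq_le)
      then have "l = k" using l by simp
      then show False using l m by simp
    qed
    then show ?thesis using mid[OF pm] same[of m] pm at as0 by simp
  qed
  have upd: "\<pi> = \<sigma>[as ! 0 := \<sigma> ! (as ! k), as ! k := \<sigma> ! (as ! 0)]"
    by (rule nth_equalityI) (use at same in \<open>auto simp: as0 ask nth_list_update\<close>)
  have lt: "as ! k < length \<sigma>" "\<sigma> ! (as ! 0) < \<sigma> ! (as ! k)" using at iv by (simp_all add: as0 ask)
  show ?thesis
    unfolding kbruhat_cover_def \<sigma>_def[symmetric]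
    using \<sigma> \<pi>(1) len_as sorted_as lt eq gap upd by blast
qed

text \<open>The last \<open>i\<close> is exchanged with the last larger letter \<open>v\<close> in front of it. No copy of \<open>i\<close> precedes
  \<open>v\<close>, as \<open>v\<close> may not stand between two copies of \<open>i\<close>.\<close>

lemma kbruhat_cover_decrease:
  assumes k: "k \<ge> 1" and \<pi>: "\<pi> \<in> kstirling k n" and i: "i \<in> {1..n}" and pos: "row_count i \<pi> > 0"
  obtains \<sigma> where "kbruhat_cover k n \<sigma> \<pi>" "row_count i \<pi> = Suc (row_count i \<sigma>)"
    "\<And>j. j \<noteq> i \<Longrightarrow> row_count j \<sigma> = row_count j \<pi>"
proof -
  have S: "stirling_word \<pi>" using \<pi> by (simp add: kstirling_iff)
  have "i \<in> set \<pi>" using set_kstirling[OF \<pi> k] i by simp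
  then obtain P Z where PZ: "\<pi> = P @ i # Z" "i \<notin> set Z" by (meson split_list_last)
  have "\<exists>x\<in>set P. i < x"
  proof (rule ccontr)
    assume n: "\<not> ?thesis"
    have "x \<in> set P" if "x \<in> set (takeWhile (\<lambda>x. x \<noteq> i) \<pi>)" for x
      using that unfolding PZ takeWhile_append by (auto split: if_splits dest: set_takeWhileD)
    then have "row_count i \<pi> = 0" using n by (auto simp: row_count_def filter_empty_conv)
    then show False using pos by simp
  qed
  then obtain X v M where P: "P = X @ v # M" "i < v" "\<forall>x\<in>set M. \<not> i < x"
    using split_list_last_prop[of P "\<lambda>x. i < x"] by blast
  have e: "\<pi> = X @ v # M @ i # Z" by (simp add: PZ P)
  have M: "x \<le> i" if "x \<in> set M" for x using that P(3) by auto
  have X: "i \<notin> set X"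
  proof
    assume "i \<in> set X"
    then obtain a where a: "a < length X" "X ! a = i" by (auto simp: in_set_conv_nth)
    have "\<pi> ! length X < i"
      by (rule stirling_wordD[OF S, of a "length X" "length X + 1 + length M"])
        (use a P(2) in \<open>auto simp: e nth_append\<close>)
    then show False using P(2) by (simp add: e)
  qed
  show thesis
  proof (rule that)
    show "kbruhat_cover k n (X @ i # M @ v # Z) \<pi>"
      by (rule kbruhat_cover_exchange[OF k \<pi> e P(2) M X PZ(2)])
    show "row_count i \<pi> = Suc (row_count i (X @ i # M @ v # Z))"
      unfolding e by (rule row_count_exchange(1)[OF P(2) M X])
    show "row_count j (X @ i # M @ v # Z) = row_count j \<pi>" if "j \<noteq> i" for j
      unfolding e by (rule row_count_exchange(2)[OF P(2) M X that, symmetric])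
  qed
qed

text \<open>Starting from \<open>\<pi>\<close>, entries of the code are lowered one at a time until the code of \<open>\<sigma>\<close> is reached;
  then the words agree because codes determine words.\<close>

lemma kbruhat_le_if_row_count_le:
  assumes k: "k \<ge> 1" and \<sigma>: "\<sigma> \<in> kstirling k n" and "\<pi> \<in> kstirling k n"
    and "\<And>i. i \<in> {1..n} \<Longrightarrow> row_count i \<sigma> \<le> row_count i \<pi>"
  shows "kbruhat_le k n \<sigma> \<pi>"
  using assms(3,4)
proof (induction "\<Sum>i=1..n. row_count i \<pi>" arbitrary: \<pi> rule: less_induct)
  case less
  show ?case
  proof (cases "\<forall>i\<in>{1..n}. row_count i \<pi> = row_count i \<sigma>")
    case True
    then have "\<sigma> = \<pi>" using row_count_inject[OF k \<sigma> less.prems(1)] by simp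
    then show ?thesis by (simp add: kbruhat_le_def)
  next
    case False
    then obtain i where i: "i \<in> {1..n}" "row_count i \<sigma> < row_count i \<pi>"
      using less.prems(2) by (metis le_neq_implies_less)
    then have "row_count i \<pi> > 0" by simp
    then obtain \<tau> where \<tau>: "kbruhat_cover k n \<tau> \<pi>" "row_count i \<pi> = Suc (row_count i \<tau>)"
        "\<And>j. j \<noteq> i \<Longrightarrow> row_count j \<tau> = row_count j \<pi>"
      using kbruhat_cover_decrease[OF k less.prems(1) i(1)] by blast
    have le: "row_count j \<tau> \<le> row_count j \<pi>" for j using \<tau>(2,3) by (cases "j = i") auto
    have "(\<Sum>j=1..n. row_count j \<tau>) < (\<Sum>j=1..n. row_count j \<pi>)"
      by (rule sum_strict_mono_ex1) (use le i(1) \<tau>(2) in \<open>auto intro!: bexI[of _ i]\<close>)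
    moreover have "\<tau> \<in> kstirling k n" using \<tau>(1) by (simp add: kbruhat_cover_def)
    moreover have "row_count j \<sigma> \<le> row_count j \<tau>" if "j \<in> {1..n}" for j
      using less.prems(2)[OF that] \<tau>(2,3) i(2) by (cases "j = i") auto
    ultimately have "kbruhat_le k n \<sigma> \<tau>" by (rule less.hyps)
    then show ?thesis using \<tau>(1) unfolding kbruhat_le_def by (rule rtranclp.rtrancl_into_rtrancl)
  qed
qed

text \<open>For the first direction, avoiding 132 turns the code of \<open>\<sigma>\<close> into a statement about prefixes, which
  covers preserve.\<close>

theorem kbruhat_le_iff_row_count_le:
  assumes k: "k \<ge> 1" and \<sigma>: "\<sigma> \<in> kstirling k n" "avoids_132 \<sigma>" and \<pi>: "\<pi> \<in> kstirling k n"
  shows "kbruhat_le k n \<sigma> \<pi> \<longleftrightarrow> (\<forall>i\<in>{1..n}. row_count i \<sigma> \<le> row_count i \<pi>)"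
proof
  assume le: "kbruhat_le k n \<sigma> \<pi>"
  show "\<forall>i\<in>{1..n}. row_count i \<sigma> \<le> row_count i \<pi>"
  proof
    fix i assume "i \<in> {1..n}"
    then have "i \<in> set \<sigma>" using set_kstirling[OF \<sigma>(1) k] by simp
    then have pre: "i < \<sigma> ! j" if "j < row_count i \<sigma>" for j
      using avoids_132_prefix[OF \<sigma>(2) _ that] by simp
    have len: "row_count i \<sigma> \<le> length \<sigma>"
      unfolding row_count_def by (meson length_filter_le length_takeWhile_le order_trans)
    show "row_count i \<sigma> \<le> row_count i \<pi>"
      using kbruhat_le_prefix[OF le pre len] len by (intro le_row_count_if_prefix) auto
  qed
qed (use kbruhat_le_if_row_count_le[OF k \<sigma>(1) \<pi>] in blast)

text \<open>The first \<open>row_count (Suc i) \<sigma>\<close> letters exceed \<open>i + 1\<close>, so they all count for \<open>i\<close>.\<close>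

lemma row_count_antimono:
  assumes k: "k \<ge> 1" and \<sigma>: "\<sigma> \<in> kstirling k n" "avoids_132 \<sigma>" and i: "1 \<le> i" "i < n"
  shows "row_count (Suc i) \<sigma> \<le> row_count i \<sigma>"
proof (rule le_row_count_if_prefix)
  show "row_count (Suc i) \<sigma> \<le> length \<sigma>"
    unfolding row_count_def by (meson length_filter_le length_takeWhile_le order_trans)
  have "Suc i \<in> set \<sigma>" using set_kstirling[OF \<sigma>(1) k] i by simp
  then show "i < \<sigma> ! j" if "j < row_count (Suc i) \<sigma>" for j
    using avoids_132_prefix[OF \<sigma>(2) _ that] by simp
qed

section \<open>Equality of the generating functions\<close>

theorem theorem4p11:
  fixes k n :: nat and \<sigma> :: "nat list" and \<mu> :: "step list"
  assumes "k \<ge> 1" and "n \<ge> 1"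
    and "\<sigma> \<in> kstirling k n" and "avoids_132 \<sigma>"
    and "\<mu> = alpha k n \<sigma>"
  shows "(\<Sum>D\<in>kdyck_tilings_above k n \<mu>. monom (1 :: int) (card D))
       = (\<Sum>\<pi>\<in>{\<pi> \<in> kstirling k n. kbruhat_le k n \<sigma> \<pi>}. monom 1 (invk n \<pi> - invk n \<sigma>))"
proof -
  note k = assms(1) and \<sigma> = assms(3,4)
  define c where "c = inv_row n \<sigma>"
  have row: "inv_row n \<pi> i = row_count i \<pi>" if "\<pi> \<in> kstirling k n" "i \<in> {1..n}" for \<pi> i
    by (rule inv_row_eq[OF that(1) k that(2)])
  have c: "c (Suc i) \<le> c i \<and> c i \<le> k * (n - i)" if i: "1 \<le> i" "i \<le> n" for i
  proof
    show "c i \<le> k * (n - i)"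
      using row[OF \<sigma>(1), of i] row_count_le[OF k \<sigma>(1) i] i by (simp add: c_def)
    show "c (Suc i) \<le> c i"
    proof (cases "i < n")
      case True
      then show ?thesis
        using row[OF \<sigma>(1), of i] row[OF \<sigma>(1), of "Suc i"] row_count_antimono[OF k \<sigma> i(1)] i
        by (simp add: c_def)
    next
      case False
      then have "c (Suc i) = 0" using i by (simp add: c_def inv_row_def INVk_def)
      then show ?thesis by simp
    qed
  qed
  define U where "U = {\<pi> \<in> kstirling k n. \<forall>i\<in>{1..n}. c i \<le> row_count i \<pi>}"
  have c_row: "c i = row_count i \<sigma>" if "i \<in> {1..n}" for i
    using row[OF \<sigma>(1) that] by (simp add: c_def)
  have U: "{\<pi> \<in> kstirling k n. kbruhat_le k n \<sigma> \<pi>} = U"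
    using kbruhat_le_iff_row_count_le[OF k \<sigma>] c_row by (auto simp: U_def)
  have exponent: "invk n \<pi> - invk n \<sigma> = (\<Sum>i=1..n. row_count i \<pi> - c i)" if "\<pi> \<in> U" for \<pi>
  proof -
    have "invk n \<pi> = (\<Sum>i=1..n. row_count i \<pi>)"
      unfolding invk_eq by (rule sum.cong) (use row that in \<open>auto simp: U_def\<close>)
    moreover have "invk n \<sigma> = (\<Sum>i=1..n. c i)" by (simp add: invk_eq c_def)
    moreover have "(\<Sum>i=1..n. row_count i \<pi> - c i) = (\<Sum>i=1..n. row_count i \<pi>) - (\<Sum>i=1..n. c i)"
      by (rule sum_subtractf_nat) (use that in \<open>simp add: U_def\<close>)
    ultimately show ?thesis by simp
  qed
  have "\<mu> = board_path k n c" using assms(5) by (simp add: alpha_def board_path_def c_def)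
  then have "(\<Sum>D\<in>kdyck_tilings_above k n \<mu>. monom (1 :: int) (card D)) =
      (\<Prod>i=1..n. \<Sum>t\<le>k * (n - i) - c i. monom 1 t)"
    using tilings_of_board_path[of k n c] k c by simp
  also have "\<dots> = (\<Sum>\<pi>\<in>U. monom 1 (\<Sum>i=1..n. row_count i \<pi> - c i))"
    unfolding U_def by (rule kstirling_generating_function[symmetric]) (use k c in auto)
  also have "\<dots> = (\<Sum>\<pi>\<in>U. monom 1 (invk n \<pi> - invk n \<sigma>))"
    by (rule sum.cong) (simp_all add: exponent)
  finally show ?thesis unfolding U .
qed

end
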